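(* Let $c\ge1$ and let $s>0$. There exist constants $M\ge\sqrt2$, $a>0$ and $M',M'_s>0$ such that for every $f\in H^s(I)$ and every integer $N\ge\max(cM,3)$, $$\|f-S_N(f)\|_{L^2(I)}\le M'_s\,(1+N^2)^{-s/2}\,\|f\|_{H^s(I)}+M'e^{-aN}\,\|f\|_{L^2(I)}.$$
   Context: $I=[-1,1]$ and $H^s(I)$ is the usual Sobolev space on $I$ with a standard norm. For $c>0$, the prolate spheroidal wave functions (PSWFs) $(\psi_{n,c})_{n\ge 0}$ form the orthonormal basis of $L^2(I)$ consisting of eigenfunctions of the compact integral operator $\mathcal Q_c(f)(x)=\int_{-1}^1\frac{\sin c(x-y)}{\pi(x-y)}f(y)\,dy$ on $L^2(I)$, ordered so that the corresponding eigenvalues $\lambda_n(c)$ satisfy $1>\lambda_0(c)>\lambda_1(c)>\cdots>0$. For $f\in L^2(I)$, $S_N(f)=\sum_{n<N}\langle f,\psi_{n,c}\rangle\psi_{n,c}$, where $\langle f,g\rangle=\int_{-1}^1f\overline g$. *)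

theory Defs
  imports "HOL-Analysis.Analysis"
begin

section \<open>Square-integrable functions\<close>

text \<open>Elements of \<open>L\<^sup>2\<close> are represented by functions; equality in \<open>L\<^sup>2\<close> is equality almost everywhere.\<close>

definition L2 :: "'a measure \<Rightarrow> ('a \<Rightarrow> complex) set" where
  "L2 \<Omega> = {f \<in> borel_measurable \<Omega>. integrable \<Omega> (\<lambda>x. (cmod (f x))\<^sup>2)}"

definition L2_inner :: "'a measure \<Rightarrow> ('a \<Rightarrow> complex) \<Rightarrow> ('a \<Rightarrow> complex) \<Rightarrow> complex" where
  "L2_inner \<Omega> f g = (\<integral>x. f x * cnj (g x) \<partial>\<Omega>)"

definition L2_norm :: "'a measure \<Rightarrow> ('a \<Rightarrow> complex) \<Rightarrow> real" where
  "L2_norm \<Omega> f = sqrt (\<integral>x. (cmod (f x))\<^sup>2 \<partial>\<Omega>)"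

abbreviation I_meas :: "real measure" where
  "I_meas \<equiv> lebesgue_on {-1..1}"

section \<open>Sobolev spaces\<close>

text \<open>The Plancherel transform with the unitary normalisation: \<open>G\<close> is the \<open>L\<^sup>2\<close> limit of the
  Fourier transforms of the truncations of \<open>F\<close> to \<open>{-R..R}\<close>. It determines \<open>G\<close> up to null sets.
  The convergence is stated with the extended nonnegative integral because the Bochner integral of
  a function that is not integrable is \<open>0\<close>.\<close>

definition fourier_trunc :: "(real \<Rightarrow> complex) \<Rightarrow> real \<Rightarrow> real \<Rightarrow> complex" where
  "fourier_trunc F R \<xi> =
     complex_of_real (1 / sqrt (2 * pi)) * (LINT x:{-R..R}|lebesgue. F x * cis (- (x * \<xi>)))"

definition has_fourier_L2 :: "(real \<Rightarrow> complex) \<Rightarrow> (real \<Rightarrow> complex) \<Rightarrow> bool" where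
  "has_fourier_L2 F G \<longleftrightarrow> F \<in> L2 lebesgue \<and> G \<in> L2 lebesgue \<and>
     ((\<lambda>R. \<integral>\<^sup>+\<xi>. ennreal ((cmod (fourier_trunc F R \<xi> - G \<xi>))\<^sup>2) \<partial>lebesgue) \<longlongrightarrow> 0) at_top"

text \<open>\<open>H\<^sup>s(I)\<close> for real \<open>s \<ge> 0\<close> consists of the restrictions to \<open>I\<close> of the functions of \<open>H\<^sup>s(\<real>)\<close>,
  with the quotient norm; \<open>H\<^sup>s(\<real>)\<close> and its norm are given by the weight \<open>(1 + \<xi>\<^sup>2)\<^sup>s\<close> on the Fourier
  side. An extension of \<open>f\<close> is recorded together with (a representative of) its transform.\<close>

definition sobolev_weighted :: "real \<Rightarrow> (real \<Rightarrow> complex) \<Rightarrow> real \<Rightarrow> real" where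
  "sobolev_weighted s G \<xi> = (1 + \<xi>\<^sup>2) powr s * (cmod (G \<xi>))\<^sup>2"

definition sobolev_ext ::
    "real \<Rightarrow> (real \<Rightarrow> complex) \<Rightarrow> ((real \<Rightarrow> complex) \<times> (real \<Rightarrow> complex)) set" where
  "sobolev_ext s f = {(F, G). has_fourier_L2 F G \<and> integrable lebesgue (sobolev_weighted s G) \<and>
     (AE x in I_meas. F x = f x)}"

definition sobolev :: "real \<Rightarrow> (real \<Rightarrow> complex) set" where
  "sobolev s = {f \<in> L2 I_meas. sobolev_ext s f \<noteq> {}}"

definition sobolev_norm :: "real \<Rightarrow> (real \<Rightarrow> complex) \<Rightarrow> real" where
  "sobolev_norm s f = (INF (F, G) \<in> sobolev_ext s f. sqrt (\<integral>\<xi>. sobolev_weighted s G \<xi> \<partial>lebesgue))"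

section \<open>Prolate spheroidal wave functions\<close>

text \<open>At \<open>y = x\<close> the kernel takes the value \<open>0\<close> instead of \<open>c / \<pi>\<close>; this does not affect the integral.\<close>

definition sinc_op :: "real \<Rightarrow> (real \<Rightarrow> complex) \<Rightarrow> real \<Rightarrow> complex" where
  "sinc_op c f x =
     (\<integral>y. complex_of_real (sin (c * (x - y)) / (pi * (x - y))) * f y \<partial>I_meas)"

definition partial_expansion ::
    "(nat \<Rightarrow> real \<Rightarrow> complex) \<Rightarrow> nat \<Rightarrow> (real \<Rightarrow> complex) \<Rightarrow> real \<Rightarrow> complex" where
  "partial_expansion \<psi> N f x = (\<Sum>n<N. L2_inner I_meas f (\<psi> n) * \<psi> n x)"

definition orthonormal_basis_I :: "(nat \<Rightarrow> real \<Rightarrow> complex) \<Rightarrow> bool" where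
  "orthonormal_basis_I \<psi> \<longleftrightarrow>
     (\<forall>n. \<psi> n \<in> L2 I_meas) \<and>
     (\<forall>m n. L2_inner I_meas (\<psi> m) (\<psi> n) = (if m = n then 1 else 0)) \<and>
     (\<forall>f\<in>L2 I_meas. (\<lambda>N. L2_norm I_meas (\<lambda>x. f x - partial_expansion \<psi> N f x)) \<longlonglongrightarrow> 0)"

text \<open>The eigenvalues \<open>\<mu> n\<close> being strictly decreasing, \<open>\<psi>\<close> is determined by \<open>c\<close> up to unimodular
  factors, which do not affect \<^const>\<open>partial_expansion\<close>, and up to null sets.\<close>

definition pswf :: "real \<Rightarrow> (nat \<Rightarrow> real) \<Rightarrow> (nat \<Rightarrow> real \<Rightarrow> complex) \<Rightarrow> bool" where
  "pswf c \<mu> \<psi> \<longleftrightarrow>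
     orthonormal_basis_I \<psi> \<and>
     (\<forall>n. AE x in I_meas. sinc_op c (\<psi> n) x = complex_of_real (\<mu> n) * \<psi> n x) \<and>
     \<mu> 0 < 1 \<and> (\<forall>n. \<mu> (Suc n) < \<mu> n) \<and> (\<forall>n. 0 < \<mu> n)"

end

theory Submission
  imports Defs "HOL-Probability.Probability" "HOL-Real_Asymp.Real_Asymp"
begin

text \<open>Let \<open>h\<^sub>n(\<xi>)\<close> be the integral of \<open>\<psi>\<^sub>n(y) exp(-iy\<xi>)\<close> over \<open>I\<close>. Everything rests on the claim that \<open>h\<^sub>n\<close>
  is exponentially small on \<open>|\<xi>| \<le> n/64\<close>. Given an extension \<open>F\<close> of \<open>f\<close> with transform \<open>G\<close>, Plancherel
  turns \<open>\<langle>f, \<psi>\<^sub>n\<rangle>\<close> into the inner product of \<open>G\<close> with the transform of \<open>\<psi>\<^sub>n\<close>. For \<open>n \<ge> N\<close> the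
  frequencies \<open>|\<xi>| \<le> N/64\<close> contribute an exponentially small amount by the claim, and Bessel's
  inequality in \<open>L\<^sup>2(\<real>)\<close> bounds the contribution of the others through the weight \<open>(1 + \<xi>\<^sup>2)\<^sup>s\<close>.

  To prove the claim, use that the \<open>h\<^sub>n\<close> are orthogonal in \<open>L\<^sup>2(-c, c)\<close> with squared norm \<open>2\<pi>\<mu>\<^sub>n\<close>. Some
  combination of \<open>\<psi>\<^sub>0, \<dots>, \<psi>\<^sub>n\<close> is orthogonal to all polynomials of degree below \<open>n\<close>, so a Taylor
  expansion gives \<open>\<mu>\<^sub>n \<le> c (n + 1) (c\<^sup>n/n!)\<^sup>2\<close>. As \<open>h\<^sub>n\<close> is Lipschitz, it is super-exponentially small
  on \<open>[-c, c]\<close>. With \<open>K = n\<^sup>2\<close>, expanding \<open>exp(-iy\<xi>) = (1 + z)\<^sup>K\<close> for \<open>z = exp(-iy\<xi>/K) - 1\<close> extrapolates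
  this to \<open>|\<xi>| \<le> n/64\<close>: the first \<open>n/4\<close> powers of \<open>z\<close> only involve frequencies in \<open>[-c, c]\<close>, and
  the others are dominated by the tail of the exponential series.\<close>

section \<open>Square-integrable functions\<close>

lemma borel_measurable_cnj [measurable (raw)]:
  "f \<in> borel_measurable M \<Longrightarrow> (\<lambda>x. cnj (f x)) \<in> borel_measurable M"
  by (rule measurable_compose[of f M borel]) (auto intro!: borel_measurable_continuous_onI continuous_intros)

lemma L2_measurable: "f \<in> L2 \<Omega> \<Longrightarrow> f \<in> borel_measurable \<Omega>"
  and L2_integrable: "f \<in> L2 \<Omega> \<Longrightarrow> integrable \<Omega> (\<lambda>x. (cmod (f x))\<^sup>2)"
  by (auto simp: L2_def)

lemma L2_norm_nonneg [simp]: "0 \<le> L2_norm \<Omega> f"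
  by (simp add: L2_norm_def)

lemma L2_norm_power2: "(L2_norm \<Omega> f)\<^sup>2 = (\<integral>x. (cmod (f x))\<^sup>2 \<partial>\<Omega>)"
  by (simp add: L2_norm_def)

lemma L2_inner_cong_AE:
  assumes "f \<in> borel_measurable \<Omega>" "f' \<in> borel_measurable \<Omega>" "AE x in \<Omega>. f x = f' x"
    and "g \<in> borel_measurable \<Omega>" "g' \<in> borel_measurable \<Omega>" "AE x in \<Omega>. g x = g' x"
  shows "L2_inner \<Omega> f g = L2_inner \<Omega> f' g'"
  unfolding L2_inner_def
proof (rule integral_cong_AE)
  show "AE x in \<Omega>. f x * cnj (g x) = f' x * cnj (g' x)"
    using assms(3,6) by eventually_elim simp
qed (use assms in measurable)

lemma L2_mult_integrable:
  assumes "f \<in> L2 \<Omega>" "g \<in> L2 \<Omega>"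
  shows "integrable \<Omega> (\<lambda>x. f x * cnj (g x))"
proof -
  have [measurable]: "f \<in> borel_measurable \<Omega>" "g \<in> borel_measurable \<Omega>"
    using assms by (auto simp: L2_def)
  show ?thesis
  proof (rule Bochner_Integration.integrable_bound)
    show "integrable \<Omega> (\<lambda>x. (cmod (f x))\<^sup>2 + (cmod (g x))\<^sup>2)"
      using assms by (simp add: L2_def)
    have "cmod (f x) * cmod (g x) \<le> (cmod (f x))\<^sup>2 + (cmod (g x))\<^sup>2" for x
      using sum_squares_bound[of "cmod (f x)" "cmod (g x)"]
        mult_nonneg_nonneg[OF norm_ge_zero norm_ge_zero, of "f x" "g x"] by linarith
    then show "AE x in \<Omega>. norm (f x * cnj (g x)) \<le> norm ((cmod (f x))\<^sup>2 + (cmod (g x))\<^sup>2)"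
      by (simp add: norm_mult)
  qed measurable
qed

lemma L2_add:
  assumes "f \<in> L2 \<Omega>" "g \<in> L2 \<Omega>"
  shows "(\<lambda>x. f x + g x) \<in> L2 \<Omega>"
proof -
  have [measurable]: "f \<in> borel_measurable \<Omega>" "g \<in> borel_measurable \<Omega>"
    using assms by (auto simp: L2_def)
  have "integrable \<Omega> (\<lambda>x. (cmod (f x + g x))\<^sup>2)"
  proof (rule Bochner_Integration.integrable_bound)
    show "integrable \<Omega> (\<lambda>x. 2 * (cmod (f x))\<^sup>2 + 2 * (cmod (g x))\<^sup>2)"
      using assms by (simp add: L2_def)
    have "(cmod (f x + g x))\<^sup>2 \<le> (cmod (f x) + cmod (g x))\<^sup>2" for x
      by (intro power_mono norm_triangle_ineq) simp
    also have "(cmod (f x) + cmod (g x))\<^sup>2 \<le> 2 * (cmod (f x))\<^sup>2 + 2 * (cmod (g x))\<^sup>2" for x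
      using sum_squares_bound[of "cmod (f x)" "cmod (g x)"] by (simp add: power2_sum)
    finally show "AE x in \<Omega>. norm ((cmod (f x + g x))\<^sup>2)
        \<le> norm (2 * (cmod (f x))\<^sup>2 + 2 * (cmod (g x))\<^sup>2)"
      by simp
  qed measurable
  then show ?thesis using assms by (simp add: L2_def)
qed

lemma L2_scale: "f \<in> L2 \<Omega> \<Longrightarrow> (\<lambda>x. a * f x) \<in> L2 \<Omega>"
  by (auto simp: L2_def norm_mult power_mult_distrib)

lemma L2_diff: "f \<in> L2 \<Omega> \<Longrightarrow> g \<in> L2 \<Omega> \<Longrightarrow> (\<lambda>x. f x - g x) \<in> L2 \<Omega>"
  using L2_add[of f \<Omega> "\<lambda>x. (-1) * g x"] L2_scale[of g \<Omega> "-1"] by simp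

lemma L2_sum:
  assumes "\<And>i. i \<in> A \<Longrightarrow> e i \<in> L2 \<Omega>"
  shows "(\<lambda>x. \<Sum>i\<in>A. a i * e i x) \<in> L2 \<Omega>"
  using assms
proof (induction A rule: infinite_finite_induct)
  case (insert i A)
  then show ?case
    using L2_add[OF L2_scale[of "e i" \<Omega> "a i"], of "\<lambda>x. \<Sum>i\<in>A. a i * e i x"] by simp
qed (simp_all add: L2_def)

lemma L2_cutoff:
  assumes "f \<in> L2 \<Omega>" "A \<in> sets \<Omega>"
  shows "(\<lambda>x. indicator A x * f x) \<in> L2 \<Omega>"
proof -
  have m: "(\<lambda>x. indicator A x * f x) \<in> borel_measurable \<Omega>"
    using assms by (auto simp: L2_def)
  have "integrable \<Omega> (\<lambda>x. (cmod (indicator A x * f x))\<^sup>2)"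
    by (rule Bochner_Integration.integrable_bound[OF L2_integrable[OF assms(1)]])
      (use m in \<open>auto simp: indicator_def\<close>)
  with m show ?thesis by (simp add: L2_def)
qed

lemma L2_inner_self: "L2_inner \<Omega> f f = complex_of_real ((L2_norm \<Omega> f)\<^sup>2)"
  unfolding L2_inner_def L2_norm_power2
  by (simp add: complex_norm_square[symmetric] del: of_real_power flip: integral_complex_of_real)

lemma L2_inner_commute: "L2_inner \<Omega> g f = cnj (L2_inner \<Omega> f g)"
  unfolding L2_inner_def
  by (simp add: mult.commute flip: Bochner_Integration.integral_cnj)

lemma L2_inner_diff_left:
  assumes "f \<in> L2 \<Omega>" "g \<in> L2 \<Omega>" "k \<in> L2 \<Omega>"
  shows "L2_inner \<Omega> (\<lambda>x. f x - g x) k = L2_inner \<Omega> f k - L2_inner \<Omega> g k"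
  using assms unfolding L2_inner_def
  by (simp add: left_diff_distrib Bochner_Integration.integral_diff L2_mult_integrable)

lemma L2_inner_sum_left:
  assumes "\<And>i. i \<in> A \<Longrightarrow> e i \<in> L2 \<Omega>" "k \<in> L2 \<Omega>"
  shows "L2_inner \<Omega> (\<lambda>x. \<Sum>i\<in>A. a i * e i x) k = (\<Sum>i\<in>A. a i * L2_inner \<Omega> (e i) k)"
  using assms unfolding L2_inner_def
  by (simp add: sum_distrib_right mult.assoc Bochner_Integration.integral_sum L2_mult_integrable)

lemma L2_Cauchy_Schwarz:
  assumes f: "f \<in> L2 \<Omega>" and g: "g \<in> L2 \<Omega>"
  shows "cmod (L2_inner \<Omega> f g) \<le> L2_norm \<Omega> f * L2_norm \<Omega> g"
proof -
  let ?I = "\<lambda>x. cmod (f x) * cmod (g x)"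
  have [measurable]: "f \<in> borel_measurable \<Omega>" "g \<in> borel_measurable \<Omega>"
    using assms by (auto simp: L2_def)
  have int: "integrable \<Omega> ?I"
    using integrable_norm[OF L2_mult_integrable[OF f g]] by (simp add: norm_mult)
  have "(\<integral>\<^sup>+x. ennreal (?I x) \<partial>\<Omega>)\<^sup>2
      \<le> (\<integral>\<^sup>+x. ennreal ((cmod (f x))\<^sup>2) \<partial>\<Omega>) * (\<integral>\<^sup>+x. ennreal ((cmod (g x))\<^sup>2) \<partial>\<Omega>)"
    using Cauchy_Schwarz_nn_integral[of "\<lambda>x. ennreal (cmod (f x))" \<Omega> "\<lambda>x. ennreal (cmod (g x))"]
    by (simp add: ennreal_mult' ennreal_power)
  then have "(\<integral>x. ?I x \<partial>\<Omega>)\<^sup>2 \<le> (L2_norm \<Omega> f * L2_norm \<Omega> g)\<^sup>2"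
    using f g int
    by (simp add: nn_integral_eq_integral L2_integrable L2_norm_power2 power_mult_distrib
        ennreal_power flip: ennreal_mult')
  then have "(\<integral>x. ?I x \<partial>\<Omega>) \<le> L2_norm \<Omega> f * L2_norm \<Omega> g"
    by (rule power2_le_imp_le) simp
  moreover have "cmod (L2_inner \<Omega> f g) \<le> (\<integral>x. ?I x \<partial>\<Omega>)"
    unfolding L2_inner_def using integral_norm_bound[of \<Omega> "\<lambda>x. f x * cnj (g x)"]
    by (simp add: norm_mult)
  ultimately show ?thesis by linarith
qed

section \<open>Orthonormal families, projections and Bessel's inequality\<close>

text \<open>The measure is a parameter because two families are needed: the \<psi> n on the interval
  and their Fourier transforms on the whole line.\<close>

definition L2_orthonormal :: "'a measure \<Rightarrow> (nat \<Rightarrow> 'a \<Rightarrow> complex) \<Rightarrow> bool" where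
  "L2_orthonormal \<Omega> e \<longleftrightarrow> (\<forall>n. e n \<in> L2 \<Omega>) \<and>
     (\<forall>m n. L2_inner \<Omega> (e m) (e n) = (if m = n then 1 else 0))"

text \<open>Pythagoras: the inner products of the projection \<open>p\<close> with \<open>f\<close>
  and with itself are both the sum of the squared coefficients. The identity is kept exact because
  it yields Bessel's inequality and also the error of a partial expansion.\<close>

lemma L2_norm_diff_projection:
  assumes e: "L2_orthonormal \<Omega> e" and f: "f \<in> L2 \<Omega>" and A: "finite A"
  shows "(L2_norm \<Omega> (\<lambda>x. f x - (\<Sum>n\<in>A. L2_inner \<Omega> f (e n) * e n x)))\<^sup>2
    = (L2_norm \<Omega> f)\<^sup>2 - (\<Sum>n\<in>A. (cmod (L2_inner \<Omega> f (e n)))\<^sup>2)"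
proof -
  define a where "a n = L2_inner \<Omega> f (e n)" for n
  define p where "p = (\<lambda>x. \<Sum>n\<in>A. a n * e n x)"
  have eL: "e n \<in> L2 \<Omega>" for n using e by (simp add: L2_orthonormal_def)
  have pL: "p \<in> L2 \<Omega>" unfolding p_def by (intro L2_sum eL)
  have pe: "L2_inner \<Omega> p (e n) = a n" if "n \<in> A" for n
  proof -
    have "L2_inner \<Omega> p (e n) = (\<Sum>i\<in>A. a i * (if i = n then 1 else 0))"
      using e unfolding p_def L2_inner_sum_left[OF eL eL] L2_orthonormal_def by simp
    also have "\<dots> = a n"
      using A that by (simp add: if_distrib cong: if_cong)
    finally show ?thesis .
  qed
  have ps: "L2_inner \<Omega> p k = (\<Sum>n\<in>A. a n * L2_inner \<Omega> (e n) k)" if "k \<in> L2 \<Omega>" for k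
    unfolding p_def by (rule L2_inner_sum_left[OF eL that])
  have pf: "L2_inner \<Omega> p f = of_real (\<Sum>n\<in>A. (cmod (a n))\<^sup>2)"
    unfolding ps[OF f] L2_inner_commute[of \<Omega> "e _" f] a_def
    by (simp only: complex_norm_square[symmetric] of_real_sum)
  have pp: "L2_inner \<Omega> p p = of_real (\<Sum>n\<in>A. (cmod (a n))\<^sup>2)"
    unfolding ps[OF pL] L2_inner_commute[of \<Omega> "e _" p]
    using pe by (simp only: complex_norm_square[symmetric] of_real_sum cong: sum.cong)
  have fp: "L2_inner \<Omega> f p = of_real (\<Sum>n\<in>A. (cmod (a n))\<^sup>2)"
    using pf L2_inner_commute[of \<Omega> f p] by simp
  have d: "(\<lambda>x. f x - p x) \<in> L2 \<Omega>" by (intro L2_diff f pL)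
  let ?d = "\<lambda>x. f x - p x"
  have "L2_inner \<Omega> ?d ?d = cnj (L2_inner \<Omega> ?d f) - cnj (L2_inner \<Omega> ?d p)"
    using L2_inner_diff_left[OF f pL d] L2_inner_commute[of \<Omega> ?d f] L2_inner_commute[of \<Omega> ?d p]
    by simp
  also have "\<dots> = of_real ((L2_norm \<Omega> f)\<^sup>2 - (\<Sum>n\<in>A. (cmod (a n))\<^sup>2))"
    by (simp only: L2_inner_diff_left[OF f pL] f pL pf fp pp L2_inner_self[of _ f]) simp
  finally have "(L2_norm \<Omega> ?d)\<^sup>2 = (L2_norm \<Omega> f)\<^sup>2 - (\<Sum>n\<in>A. (cmod (a n))\<^sup>2)"
    unfolding L2_inner_self of_real_eq_iff .
  then show ?thesis by (simp add: p_def a_def)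
qed

lemma L2_Bessel:
  assumes "L2_orthonormal \<Omega> e" "f \<in> L2 \<Omega>" "finite A"
  shows "(\<Sum>n\<in>A. (cmod (L2_inner \<Omega> f (e n)))\<^sup>2) \<le> (L2_norm \<Omega> f)\<^sup>2"
  using L2_norm_diff_projection[OF assms]
    zero_le_power2[of "L2_norm \<Omega> (\<lambda>x. f x - (\<Sum>n\<in>A. L2_inner \<Omega> f (e n) * e n x))"]
  by linarith

section \<open>The Plancherel identity\<close>

text \<open>The product \<open>f x * g y\<close> is integrable on the product space, and a bounded
  factor preserves this. Every kernel used below is a complex exponential, with
  \<open>B = 1\<close>.\<close>

lemma Fubini_bounded_kernel:
  fixes f :: "'a \<Rightarrow> complex" and g :: "'b \<Rightarrow> complex" and k :: "'a \<Rightarrow> 'b \<Rightarrow> complex"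
  assumes M: "sigma_finite_measure M" and N: "sigma_finite_measure N"
    and f: "integrable M f" and g: "integrable N g"
    and k [measurable]: "(\<lambda>(x, y). k x y) \<in> borel_measurable (M \<Otimes>\<^sub>M N)"
    and B: "\<And>x y. cmod (k x y) \<le> B"
  shows "integrable M (\<lambda>x. f x * (\<integral>y. g y * k x y \<partial>N))"
    and "(\<integral>x. f x * (\<integral>y. g y * k x y \<partial>N) \<partial>M) = (\<integral>y. g y * (\<integral>x. f x * k x y \<partial>M) \<partial>N)"
proof -
  interpret pair_sigma_finite M N using M N by (simp add: pair_sigma_finite_def)
  have [measurable]: "f \<in> borel_measurable M" "g \<in> borel_measurable N"
    using f g by auto
  let ?F = "\<lambda>(x, y). f x * g y"
  have F: "integrable (M \<Otimes>\<^sub>M N) ?F"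
    by (rule Fubini_integrable) (use f g in \<open>simp_all add: norm_mult\<close>)
  have int: "integrable (M \<Otimes>\<^sub>M N) (\<lambda>(x, y). f x * g y * k x y)"
  proof (rule Bochner_Integration.integrable_bound)
    show "integrable (M \<Otimes>\<^sub>M N) (\<lambda>z. B * norm (?F z))"
      using F by (intro integrable_mult_right integrable_norm)
    have "cmod (f x * g y * k x y) \<le> \<bar>B\<bar> * cmod (f x * g y)" for x y
      using mult_left_mono[OF order_trans[OF B abs_ge_self[of B]], of "cmod (f x * g y)" x y]
      by (simp add: norm_mult mult.commute)
    then show "AE z in M \<Otimes>\<^sub>M N. norm ((\<lambda>(x, y). f x * g y * k x y) z) \<le> norm (B * norm (?F z))"
      by (auto simp: abs_mult)
  qed measurable
  have 1: "(\<integral>y. f x * g y * k x y \<partial>N) = f x * (\<integral>y. g y * k x y \<partial>N)" for x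
    by (simp add: mult.assoc)
  have 2: "(\<integral>x. f x * g y * k x y \<partial>M) = g y * (\<integral>x. f x * k x y \<partial>M)" for y
  proof -
    have "(\<lambda>x. f x * g y * k x y) = (\<lambda>x. g y * (f x * k x y))"
      by (simp add: mult_ac)
    then show ?thesis by simp
  qed
  show "integrable M (\<lambda>x. f x * (\<integral>y. g y * k x y \<partial>N))"
    using integrable_fst'[OF int] by (simp add: 1)
  show "(\<integral>x. f x * (\<integral>y. g y * k x y \<partial>N) \<partial>M) = (\<integral>y. g y * (\<integral>x. f x * k x y \<partial>M) \<partial>N)"
    using Fubini_integral[OF int] by (simp add: 1 2)
qed

section \<open>Measurability over Lebesgue measures and their products\<close>

lemma sigma_finite_lebesgue: "sigma_finite_measure (lebesgue :: real measure)"
proof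
  show "\<exists>A. countable A \<and> A \<subseteq> sets lebesgue \<and> \<Union> A = space (lebesgue :: real measure)
      \<and> (\<forall>a\<in>A. emeasure lebesgue a \<noteq> \<infinity>)"
  proof (intro exI conjI)
    show "\<Union> (range (\<lambda>n. {- real n..real n})) = space lebesgue"
    proof -
      have "x \<in> \<Union> (range (\<lambda>n. {- real n..real n}))" for x
        using real_arch_simple[of "\<bar>x\<bar>"] by (force simp: abs_le_iff)
      then show ?thesis by auto
    qed
  qed auto
qed

lemma finite_I_meas: "finite_measure I_meas"
  by (rule finite_measureI) (simp add: emeasure_restrict_space)

lemma cis_measurable [measurable]: "cis \<in> borel_measurable borel"
  by (intro borel_measurable_continuous_onI continuous_intros)

lemma id_lebesgue: "(\<lambda>x. x) \<in> borel_measurable lebesgue"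
  using id_borel_measurable_lebesgue by (simp add: id_def)

lemma id_lebesgue_on: "(\<lambda>x. x) \<in> borel_measurable (lebesgue_on A)"
  using id_borel_measurable_lebesgue_on by (simp add: id_def)

lemma borel_measurable_lebesgue:
  "f \<in> borel_measurable borel \<Longrightarrow> f \<in> borel_measurable lebesgue"
  by (rule measurable_compose[OF id_lebesgue])

text \<open>The sigma-algebras of \<open>M\<close> and \<open>N\<close> may be larger than Borel, as
  for \<open>lebesgue\<close>; measurability of the identity into \<open>borel\<close> lets
  \<open>h\<close> be treated as a Borel function of a pair.\<close>

lemma continuous_on_measurable_pair:
  fixes h :: "real \<times> real \<Rightarrow> complex"
  assumes "continuous_on UNIV h"
    and M: "(\<lambda>x. x) \<in> borel_measurable M" and N: "(\<lambda>x. x) \<in> borel_measurable N"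
  shows "h \<in> borel_measurable (M \<Otimes>\<^sub>M N)"
proof -
  have "h \<in> borel_measurable (borel \<Otimes>\<^sub>M borel)"
    unfolding borel_prod using assms(1) by (rule borel_measurable_continuous_onI)
  moreover have "(\<lambda>z. (fst z, snd z)) \<in> measurable (M \<Otimes>\<^sub>M N) (borel \<Otimes>\<^sub>M borel)"
    by (intro measurable_Pair measurable_compose[OF measurable_fst M]
        measurable_compose[OF measurable_snd N])
  ultimately show ?thesis
    using measurable_compose[of "\<lambda>z. (fst z, snd z)" _ _ h] by simp
qed

section \<open>Gaussian regularisation of the Fourier transform\<close>

text \<open>Substituting \<open>\<xi> = z / \<epsilon>\<close> leaves the characteristic function of
  the standard normal distribution.\<close>

lemma integral_cis_gaussian:
  assumes "\<epsilon> > 0"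
  shows "(\<integral>\<xi>. complex_of_real (exp (- (\<epsilon> * \<xi>)\<^sup>2 / 2)) * cis (t * \<xi>) \<partial>lborel)
    = complex_of_real (sqrt (2 * pi) / \<epsilon> * exp (- (t / \<epsilon>)\<^sup>2 / 2))"
proof -
  have "(\<integral>\<xi>. complex_of_real (exp (- (\<epsilon> * \<xi>)\<^sup>2 / 2)) * cis (t * \<xi>) \<partial>lborel)
    = (1/\<epsilon>) *\<^sub>R (\<integral>z. complex_of_real (exp (- z\<^sup>2 / 2)) * cis (t / \<epsilon> * z) \<partial>lborel)"
    using assms by (subst lborel_integral_real_affine[of "1/\<epsilon>" _ 0]) (auto simp: field_simps)
  also have "(\<integral>z. complex_of_real (exp (- z\<^sup>2 / 2)) * cis (t / \<epsilon> * z) \<partial>lborel)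
    = sqrt (2 * pi) *\<^sub>R (\<integral>z. std_normal_density z *\<^sub>R iexp (t / \<epsilon> * z) \<partial>lborel)"
    by (subst integral_scaleR_right[symmetric])
      (intro Bochner_Integration.integral_cong refl,
        simp add: std_normal_density_def scaleR_conv_of_real cis_conv_exp mult_ac)
  also have "(\<integral>z. std_normal_density z *\<^sub>R iexp (t / \<epsilon> * z) \<partial>lborel) = char std_normal_distribution (t / \<epsilon>)"
    unfolding char_def by (subst integral_density) auto
  finally show ?thesis
    by (simp add: char_std_normal_distribution scaleR_conv_of_real)
qed

text \<open>Same normalisation as \<open>fourier_trunc\<close>, so that truncated transforms are
  instances. The value is meaningful for integrable functions only; otherwise the Bochner integral
  is 0.\<close>

definition fourier :: "(real \<Rightarrow> complex) \<Rightarrow> real \<Rightarrow> complex" where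
  "fourier f \<xi> = complex_of_real (1 / sqrt (2 * pi)) * (\<integral>x. f x * cis (- (x * \<xi>)) \<partial>lebesgue)"

text \<open>Only the integration variable carries the Lebesgue sigma-algebra; the parameter \<xi> is
  Borel. A Borel transform is what allows passing between integrals over \<open>lborel\<close> and
  over \<open>lebesgue\<close>.\<close>

lemma fourier_measurable_borel [measurable]:
  assumes "f \<in> borel_measurable lebesgue"
  shows "fourier f \<in> borel_measurable borel"
proof -
  interpret sigma_finite_measure "lebesgue :: real measure" by (rule sigma_finite_lebesgue)
  have [measurable]: "(\<lambda>(\<xi>, x). cis (- (x * \<xi>))) \<in> borel_measurable (borel \<Otimes>\<^sub>M lebesgue)"
    by (rule continuous_on_measurable_pair)
      (auto simp: case_prod_beta intro!: continuous_intros id_lebesgue)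
  note assms[measurable]
  show ?thesis unfolding fourier_def [abs_def] by measurable
qed

lemma fourier_bounded:
  assumes "integrable lebesgue f"
  shows "cmod (fourier f \<xi>) \<le> (\<integral>x. cmod (f x) \<partial>lebesgue)"
proof -
  have "cmod (\<integral>x. f x * cis (- (x * \<xi>)) \<partial>lebesgue) \<le> (\<integral>x. cmod (f x) \<partial>lebesgue)"
    using integral_norm_bound[of lebesgue "\<lambda>x. f x * cis (- (x * \<xi>))"] by (simp add: norm_mult)
  moreover have "1 / sqrt (2 * pi) \<le> 1"
    using pi_gt3 by (simp add: divide_simps)
  ultimately have "cmod (\<integral>x. f x * cis (- (x * \<xi>)) \<partial>lebesgue) * (1 / sqrt (2 * pi))
      \<le> (\<integral>x. cmod (f x) \<partial>lebesgue) * 1"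
    by (intro mult_mono) auto
  then show ?thesis
    unfolding fourier_def norm_mult norm_of_real by (simp add: mult.commute)
qed

lemma gaussian_integrable:
  fixes \<epsilon> :: real
  assumes "\<epsilon> > 0"
  shows "integrable lborel (\<lambda>\<xi>. exp (- (\<epsilon> * \<xi>)\<^sup>2 / 2))"
proof -
  have "integrable lborel (\<lambda>z. sqrt (2 * pi) * std_normal_density z)"
    by (intro integrable_mult_right integrable_normal_density) simp
  then have "integrable lborel (\<lambda>z. exp (- z\<^sup>2 / 2) :: real)"
    by (simp add: std_normal_density_def)
  from lborel_integrable_real_affine[OF this, of \<epsilon> 0] show ?thesis
    using assms by simp
qed

text \<open>A regularised Plancherel identity: the Gaussian weight makes every integrand absolutely
  integrable, at the price of replacing \<phi> by its average against a Gaussian of width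
  \<epsilon>. Letting \<epsilon> tend to 0 recovers the inner products themselves.\<close>

lemma fourier_gaussian_inner:
  fixes f \<phi> :: "real \<Rightarrow> complex" and \<epsilon> :: real
  assumes f: "integrable lebesgue f"
    and \<phi>: "integrable lborel \<phi>"
    and \<epsilon>: "\<epsilon> > 0"
  shows "(\<integral>\<xi>. (cnj (fourier \<phi> \<xi>) * complex_of_real (exp (- (\<epsilon> * \<xi>)\<^sup>2 / 2))) * fourier f \<xi> \<partial>lebesgue)
    = (\<integral>x. f x * (\<integral>z. cnj (\<phi> (x + \<epsilon> * z)) * complex_of_real (std_normal_density z) \<partial>lborel) \<partial>lebesgue)"
proof -
  have [measurable]: "f \<in> borel_measurable lebesgue" "\<phi> \<in> borel_measurable borel"
    using f \<phi> by auto
  have \<phi>L: "integrable lebesgue \<phi>" using \<phi> by (simp add: integrable_completion)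
  define \<alpha> where "\<alpha> = complex_of_real (1 / sqrt (2 * pi))"
  define G where "G \<xi> = complex_of_real (exp (- (\<epsilon> * \<xi>)\<^sup>2 / 2))" for \<xi>
  have Gm [measurable]: "G \<in> borel_measurable borel" unfolding G_def by measurable
  have G: "integrable lborel G"
    unfolding G_def using gaussian_integrable[OF \<epsilon>] by (rule integrable_of_real)
  then have GL: "integrable lebesgue G" by (simp add: integrable_completion)
  define g where "g \<xi> = cnj (fourier \<phi> \<xi>) * G \<xi>" for \<xi>
  have [measurable]: "fourier \<phi> \<in> borel_measurable borel"
    by (intro fourier_measurable_borel borel_measurable_lebesgue) measurable
  have gm [measurable]: "g \<in> borel_measurable borel" unfolding g_def by measurable
  have g: "integrable lebesgue g"
  proof (rule Bochner_Integration.integrable_bound)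
    show "integrable lebesgue (\<lambda>\<xi>. (\<integral>x. cmod (\<phi> x) \<partial>lebesgue) * norm (G \<xi>))"
      using GL by (intro integrable_mult_right integrable_norm)
    show "AE \<xi> in lebesgue. norm (g \<xi>) \<le> norm ((\<integral>x. cmod (\<phi> x) \<partial>lebesgue) * norm (G \<xi>))"
      using fourier_bounded[OF \<phi>L] unfolding g_def by (auto simp: norm_mult intro!: mult_right_mono)
  qed (rule borel_measurable_lebesgue[OF gm])
  \<comment> \<open>First exchange of integrals: the integral of the Gaussian against an exponential
    is again a Gaussian, and \<open>y = x + \<epsilon> * z\<close> turns it into the standard normal
    density.\<close>
  have inner: "(\<integral>\<xi>. g \<xi> * cis (- (x * \<xi>)) \<partial>lebesgue)
    = \<alpha> * (of_real (2 * pi) * (\<integral>z. cnj (\<phi> (x + \<epsilon> * z)) * complex_of_real (std_normal_density z) \<partial>lborel))" for x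
  proof -
    have cn: "cnj (fourier \<phi> \<xi>) = \<alpha> * (\<integral>y. cnj (\<phi> y) * cis (y * \<xi>) \<partial>lborel)" for \<xi>
      unfolding fourier_def \<alpha>_def
      by (subst integral_completion)
        (simp_all add: cis_cnj del: Bochner_Integration.integral_cnj flip: Bochner_Integration.integral_cnj)
    have "(\<integral>\<xi>. g \<xi> * cis (- (x * \<xi>)) \<partial>lebesgue) = (\<integral>\<xi>. g \<xi> * cis (- (x * \<xi>)) \<partial>lborel)"
      by (rule integral_completion) measurable
    also have "\<dots> = (\<integral>\<xi>. \<alpha> * (G \<xi> * (\<integral>y. cnj (\<phi> y) * cis ((y - x) * \<xi>) \<partial>lborel)) \<partial>lborel)"
    proof (intro Bochner_Integration.integral_cong refl)
      fix \<xi>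
      have "(\<integral>y. cnj (\<phi> y) * cis ((y - x) * \<xi>) \<partial>lborel) = (\<integral>y. cnj (\<phi> y) * cis (y * \<xi>) * cis (- (x * \<xi>)) \<partial>lborel)"
        by (intro Bochner_Integration.integral_cong refl) (simp add: cis_mult left_diff_distrib mult.assoc)
      then show "g \<xi> * cis (- (x * \<xi>)) = \<alpha> * (G \<xi> * (\<integral>y. cnj (\<phi> y) * cis ((y - x) * \<xi>) \<partial>lborel))"
        unfolding g_def cn by simp
    qed
    also have "\<dots> = \<alpha> * (\<integral>\<xi>. G \<xi> * (\<integral>y. cnj (\<phi> y) * cis ((y - x) * \<xi>) \<partial>lborel) \<partial>lborel)"
      by simp
    also have "(\<integral>\<xi>. G \<xi> * (\<integral>y. cnj (\<phi> y) * cis ((y - x) * \<xi>) \<partial>lborel) \<partial>lborel)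
      = (\<integral>y. cnj (\<phi> y) * (\<integral>\<xi>. G \<xi> * cis ((y - x) * \<xi>) \<partial>lborel) \<partial>lborel)"
      by (rule Fubini_bounded_kernel(2)[where B = 1])
        (use G \<phi> in \<open>auto simp: case_prod_beta
          intro!: sigma_finite_lborel continuous_on_measurable_pair continuous_intros\<close>)
    also have "\<dots> = (\<integral>y. cnj (\<phi> y) * complex_of_real (sqrt (2 * pi) / \<epsilon> * exp (- ((y - x) / \<epsilon>)\<^sup>2 / 2)) \<partial>lborel)"
      unfolding G_def by (simp only: integral_cis_gaussian[OF \<epsilon>])
    also have "\<dots> = \<epsilon> *\<^sub>R (\<integral>z. cnj (\<phi> (x + \<epsilon> * z)) * complex_of_real (sqrt (2 * pi) / \<epsilon> * exp (- z\<^sup>2 / 2)) \<partial>lborel)"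
      using \<epsilon> by (subst lborel_integral_real_affine[of \<epsilon> _ x]) auto
    also have "\<dots> = of_real (2 * pi) * (\<integral>z. cnj (\<phi> (x + \<epsilon> * z)) * complex_of_real (std_normal_density z) \<partial>lborel)"
      unfolding integral_scaleR_right[symmetric] integral_mult_right_zero[symmetric]
      using \<epsilon> 
      by (intro Bochner_Integration.integral_cong refl)
        (simp add: std_normal_density_def scaleR_conv_of_real field_simps flip: of_real_mult)
    finally show ?thesis .
  qed
  \<comment> \<open>Second exchange, between the integral defining \<open>fourier f\<close> and the
    one over \<xi>; \<open>g\<close> is integrable thanks to its Gaussian factor.\<close>
  have "(\<integral>\<xi>. g \<xi> * fourier f \<xi> \<partial>lebesgue) = \<alpha> * (\<integral>\<xi>. g \<xi> * (\<integral>x. f x * cis (- (x * \<xi>)) \<partial>lebesgue) \<partial>lebesgue)"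
    unfolding fourier_def \<alpha>_def[symmetric] by (simp add: mult.left_commute)
  also have "(\<integral>\<xi>. g \<xi> * (\<integral>x. f x * cis (- (x * \<xi>)) \<partial>lebesgue) \<partial>lebesgue)
      = (\<integral>x. f x * (\<integral>\<xi>. g \<xi> * cis (- (x * \<xi>)) \<partial>lebesgue) \<partial>lebesgue)"
    by (rule Fubini_bounded_kernel(2)[where B = 1])
      (use f g in \<open>auto simp: case_prod_beta
        intro!: sigma_finite_lebesgue continuous_on_measurable_pair continuous_intros id_lebesgue\<close>)
  also have "\<alpha> * \<dots> = (\<alpha> * \<alpha> * of_real (2 * pi)) *
      (\<integral>x. f x * (\<integral>z. cnj (\<phi> (x + \<epsilon> * z)) * complex_of_real (std_normal_density z) \<partial>lborel) \<partial>lebesgue)"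
    unfolding inner by (simp add: mult.left_commute[of "f _"] mult.assoc)
  also have "\<alpha> * \<alpha> * of_real (2 * pi) = 1"
    unfolding \<alpha>_def by (simp flip: of_real_mult)
  finally show ?thesis by (simp add: g_def G_def)
qed

text \<open>Dominated convergence with majorant \<open>B * std_normal_density z\<close>: the
  integrand converges pointwise by continuity at \<open>x\<close>, and the density has mass
  1.\<close>

lemma gaussian_average_tendsto:
  fixes \<phi> :: "real \<Rightarrow> complex"
  assumes [measurable]: "\<phi> \<in> borel_measurable borel"
    and B: "\<And>x. cmod (\<phi> x) \<le> B" and x: "isCont \<phi> x"
  shows "(\<lambda>k. \<integral>z. cnj (\<phi> (x + inverse (real (Suc k)) * z)) * complex_of_real (std_normal_density z) \<partial>lborel)
    \<longlonglongrightarrow> cnj (\<phi> x)"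
proof -
  have int: "integrable lborel (\<lambda>z. complex_of_real (std_normal_density z))"
    by (intro integrable_of_real integrable_normal_density) simp
  have one: "(\<integral>z. complex_of_real (std_normal_density z) \<partial>lborel) = 1"
    using integral_normal_density[of 1 0] by (subst integral_complex_of_real) simp
  have "(\<lambda>k. \<integral>z. cnj (\<phi> (x + inverse (real (Suc k)) * z)) * complex_of_real (std_normal_density z) \<partial>lborel)
    \<longlonglongrightarrow> (\<integral>z. cnj (\<phi> x) * complex_of_real (std_normal_density z) \<partial>lborel)"
  proof (rule integral_dominated_convergence)
    show "integrable lborel (\<lambda>z. B * std_normal_density z)"
      by (intro integrable_mult_right integrable_normal_density) simp
    show "AE z in lborel. (\<lambda>k. cnj (\<phi> (x + inverse (real (Suc k)) * z)) * complex_of_real (std_normal_density z))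
        \<longlonglongrightarrow> cnj (\<phi> x) * complex_of_real (std_normal_density z)"
    proof (rule AE_I2)
      fix z :: real
      have "(\<lambda>k. x + inverse (real (Suc k)) * z) \<longlonglongrightarrow> x + 0 * z"
        by (intro tendsto_intros LIMSEQ_inverse_real_of_nat)
      then have "(\<lambda>k. \<phi> (x + inverse (real (Suc k)) * z)) \<longlonglongrightarrow> \<phi> x"
        using isCont_tendsto_compose[OF x] by simp
      then show "(\<lambda>k. cnj (\<phi> (x + inverse (real (Suc k)) * z)) * complex_of_real (std_normal_density z))
        \<longlonglongrightarrow> cnj (\<phi> x) * complex_of_real (std_normal_density z)"
        by (intro tendsto_intros)
    qed
    show "AE z in lborel. norm (cnj (\<phi> (x + inverse (real (Suc k)) * z)) * complex_of_real (std_normal_density z))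
        \<le> B * std_normal_density z" for k
      using B by (auto simp: norm_mult intro!: mult_right_mono)
  qed measurable
  then show ?thesis by (simp only: integral_mult_right_zero one) simp
qed

lemma gaussian_average_bounded:
  fixes \<phi> :: "real \<Rightarrow> complex"
  assumes [measurable]: "\<phi> \<in> borel_measurable borel" and B: "\<And>x. cmod (\<phi> x) \<le> B"
  shows "cmod (\<integral>z. cnj (\<phi> (x + \<epsilon> * z)) * complex_of_real (std_normal_density z) \<partial>lborel) \<le> B"
proof -
  have i: "integrable lborel (\<lambda>z. B * std_normal_density z)"
    by (intro integrable_mult_right integrable_normal_density) simp
  have b: "cmod (cnj (\<phi> (x + \<epsilon> * z)) * complex_of_real (std_normal_density z)) \<le> B * std_normal_density z" for z
    using B by (auto simp: norm_mult intro!: mult_right_mono)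
  have "integrable lborel (\<lambda>z. cnj (\<phi> (x + \<epsilon> * z)) * complex_of_real (std_normal_density z))"
    by (rule Bochner_Integration.integrable_bound[OF i])
       (measurable, use b in \<open>auto intro: order_trans[OF _ abs_ge_self]\<close>)
  then have "cmod (\<integral>z. cnj (\<phi> (x + \<epsilon> * z)) * complex_of_real (std_normal_density z) \<partial>lborel)
      \<le> (\<integral>z. B * std_normal_density z \<partial>lborel)"
    using i b by (intro Bochner_Integration.integral_norm_bound_integral) auto
  also have "\<dots> = B" using integral_normal_density[of 1 0] by simp
  finally show ?thesis .
qed

text \<open>Dominated convergence with majorant \<open>cmod (f x) * B\<close>. Continuity is asked
  for almost everywhere only, since the functions \<phi> of interest may jump at the ends of the
  interval.\<close>

lemma gaussian_smoothing_tendsto: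
  fixes f \<phi> :: "real \<Rightarrow> complex"
  assumes f: "integrable lebesgue f"
    and \<phi> [measurable]: "\<phi> \<in> borel_measurable borel"
    and B: "\<And>x. cmod (\<phi> x) \<le> B" and cont: "AE x in lebesgue. isCont \<phi> x"
  shows "(\<lambda>k. \<integral>x. f x * (\<integral>z. cnj (\<phi> (x + inverse (real (Suc k)) * z)) * complex_of_real (std_normal_density z) \<partial>lborel) \<partial>lebesgue)
    \<longlonglongrightarrow> L2_inner lebesgue f \<phi>"
  unfolding L2_inner_def
proof (rule integral_dominated_convergence)
  let ?A = "\<lambda>k x. \<integral>z. cnj (\<phi> (x + inverse (real (Suc k)) * z)) * complex_of_real (std_normal_density z) \<partial>lborel"
  have fm: "f \<in> borel_measurable lebesgue" using f by auto
  show "(\<lambda>x. f x * cnj (\<phi> x)) \<in> borel_measurable lebesgue"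
    by (intro borel_measurable_times fm borel_measurable_lebesgue) measurable
  show "(\<lambda>x. f x * ?A k x) \<in> borel_measurable lebesgue" for k
    by (intro borel_measurable_times fm borel_measurable_lebesgue) measurable
  show "integrable lebesgue (\<lambda>x. cmod (f x) * B)"
    using f by (intro integrable_mult_left integrable_norm)
  show "AE x in lebesgue. (\<lambda>k. f x * ?A k x) \<longlonglongrightarrow> f x * cnj (\<phi> x)"
    using cont
  proof eventually_elim
    case (elim x)
    show ?case by (intro tendsto_mult_left gaussian_average_tendsto[OF \<phi> B elim])
  qed
  show "AE x in lebesgue. norm (f x * ?A k x) \<le> cmod (f x) * B" for k
    using gaussian_average_bounded[OF \<phi> B] by (auto simp: norm_mult intro!: mult_left_mono)
qed

lemma gaussian_tendsto_1:
  "(\<lambda>k. complex_of_real (exp (- (inverse (real (Suc k)) * \<xi>)\<^sup>2 / 2))) \<longlonglongrightarrow> 1"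
proof -
  have "(\<lambda>k. complex_of_real (exp (- (inverse (real (Suc k)) * \<xi>)\<^sup>2 / 2)))
      \<longlonglongrightarrow> complex_of_real (exp (- (0 * \<xi>)\<^sup>2 / 2))"
    by (intro tendsto_intros LIMSEQ_inverse_real_of_nat) simp
  then show ?thesis by simp
qed

section \<open>Plancherel for bounded, almost everywhere continuous functions\<close>

text \<open>The regularised identity with \<open>f = \<phi>\<close> shows that the Gaussian-weighted
  energies \<open>I k\<close> converge to the squared norm of \<phi>. The weights increase to 1 with
  \<open>k\<close>, so monotone convergence makes the unweighted energy finite.\<close>

lemma fourier_in_L2:
  fixes \<phi> :: "real \<Rightarrow> complex"
  assumes \<phi>: "integrable lborel \<phi>"
    and B: "\<And>x. cmod (\<phi> x) \<le> B" and cont: "AE x in lebesgue. isCont \<phi> x"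
  shows "fourier \<phi> \<in> L2 lebesgue"
proof -
  have \<phi>m [measurable]: "\<phi> \<in> borel_measurable borel" using \<phi> by auto
  have \<phi>L: "integrable lebesgue \<phi>" using \<phi> by (simp add: integrable_completion)
  have Fm [measurable]: "fourier \<phi> \<in> borel_measurable borel"
    by (intro fourier_measurable_borel borel_measurable_lebesgue \<phi>m)
  define G where "G k \<xi> = exp (- (inverse (real (Suc k)) * \<xi>)\<^sup>2 / 2)" for k \<xi>
  define I where "I k = (\<integral>\<xi>. (cmod (fourier \<phi> \<xi>))\<^sup>2 * G k \<xi> \<partial>lborel)" for k
  have Gm [measurable]: "G k \<in> borel_measurable borel" for k unfolding G_def by measurable
  define C where "C = (\<integral>x. cmod (\<phi> x) \<partial>lebesgue)"
  have bd: "cmod (fourier \<phi> \<xi>) \<le> C" for \<xi>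
    using fourier_bounded[OF \<phi>L] by (simp add: C_def)
  have int: "integrable lborel (\<lambda>\<xi>. (cmod (fourier \<phi> \<xi>))\<^sup>2 * G k \<xi>)" for k
  proof (rule Bochner_Integration.integrable_bound)
    show "integrable lborel (\<lambda>\<xi>. C\<^sup>2 * G k \<xi>)"
      unfolding G_def by (intro integrable_mult_right gaussian_integrable) simp
    show "AE \<xi> in lborel. norm ((cmod (fourier \<phi> \<xi>))\<^sup>2 * G k \<xi>) \<le> norm (C\<^sup>2 * G k \<xi>)"
      using bd by (auto simp: G_def abs_mult intro!: mult_right_mono power_mono)
  qed measurable
  have I: "complex_of_real (I k) = (\<integral>x. \<phi> x * (\<integral>z. cnj (\<phi> (x + inverse (real (Suc k)) * z)) * complex_of_real (std_normal_density z) \<partial>lborel) \<partial>lebesgue)" for k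
  proof -
    have "complex_of_real (I k) = (\<integral>\<xi>. complex_of_real ((cmod (fourier \<phi> \<xi>))\<^sup>2 * G k \<xi>) \<partial>lborel)"
      unfolding I_def by (rule integral_complex_of_real[symmetric])
    also have "\<dots> = (\<integral>\<xi>. (cnj (fourier \<phi> \<xi>) * complex_of_real (G k \<xi>)) * fourier \<phi> \<xi> \<partial>lborel)"
      by (intro Bochner_Integration.integral_cong refl, simp only: of_real_mult complex_norm_square)
        (simp add: mult_ac)
    also have "\<dots> = (\<integral>\<xi>. (cnj (fourier \<phi> \<xi>) * complex_of_real (G k \<xi>)) * fourier \<phi> \<xi> \<partial>lebesgue)"
      by (rule integral_completion[symmetric]) measurable
    finally show ?thesis
      unfolding G_def using fourier_gaussian_inner[OF \<phi>L \<phi>, of "inverse (real (Suc k))"] by simp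
  qed
  have "(\<lambda>k. complex_of_real (I k)) \<longlonglongrightarrow> complex_of_real ((L2_norm lebesgue \<phi>)\<^sup>2)"
    unfolding I L2_inner_self[symmetric] by (rule gaussian_smoothing_tendsto[OF \<phi>L \<phi>m B cont])
  then have lim: "I \<longlonglongrightarrow> (L2_norm lebesgue \<phi>)\<^sup>2"
    unfolding tendsto_of_real_iff .
  have "integrable lborel (\<lambda>\<xi>. (cmod (fourier \<phi> \<xi>))\<^sup>2)"
  proof (rule integrable_monotone_convergence[where f = "\<lambda>k \<xi>. (cmod (fourier \<phi> \<xi>))\<^sup>2 * G k \<xi>"])
    show "AE \<xi> in lborel. mono (\<lambda>k. (cmod (fourier \<phi> \<xi>))\<^sup>2 * G k \<xi>)"
    proof (intro AE_I2 monoI mult_left_mono)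
      fix \<xi> and k l :: nat
      assume "k \<le> l"
      then have "(inverse (real (Suc l)))\<^sup>2 * \<xi>\<^sup>2 \<le> (inverse (real (Suc k)))\<^sup>2 * \<xi>\<^sup>2"
        by (intro mult_right_mono power_mono le_imp_inverse_le) auto
      then show "G k \<xi> \<le> G l \<xi>"
        by (simp add: G_def power_mult_distrib)
    qed simp
    show "AE \<xi> in lborel. (\<lambda>k. (cmod (fourier \<phi> \<xi>))\<^sup>2 * G k \<xi>) \<longlonglongrightarrow> (cmod (fourier \<phi> \<xi>))\<^sup>2"
    proof (rule AE_I2)
      fix \<xi>
      have "(\<lambda>k. G k \<xi>) \<longlonglongrightarrow> 1"
        using tendsto_Re[OF gaussian_tendsto_1[of \<xi>]] unfolding G_def by simp
      then show "(\<lambda>k. (cmod (fourier \<phi> \<xi>))\<^sup>2 * G k \<xi>) \<longlonglongrightarrow> (cmod (fourier \<phi> \<xi>))\<^sup>2"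
        using tendsto_mult_left[of "\<lambda>k. G k \<xi>" 1 sequentially "(cmod (fourier \<phi> \<xi>))\<^sup>2"] by simp
    qed
  qed (use int lim[unfolded I_def [abs_def]] in simp_all)
  then show ?thesis
    by (simp add: L2_def integrable_completion borel_measurable_lebesgue)
qed

text \<open>Both sides are limits of the regularised identity. Membership of
  \<open>fourier f\<close> in \<open>L2\<close> is a premise because \<open>f\<close> is merely
  integrable here; for truncations it comes from their convergence to an \<open>L2\<close>
  function.\<close>

lemma Plancherel_inner:
  fixes f \<phi> :: "real \<Rightarrow> complex"
  assumes f: "integrable lebesgue f" and Ff: "fourier f \<in> L2 lebesgue"
    and \<phi>: "integrable lborel \<phi>"
    and B: "\<And>x. cmod (\<phi> x) \<le> B" and cont: "AE x in lebesgue. isCont \<phi> x"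
  shows "L2_inner lebesgue (fourier f) (fourier \<phi>) = L2_inner lebesgue f \<phi>"
proof -
  have \<phi>m: "\<phi> \<in> borel_measurable borel" using \<phi> by auto
  have F\<phi>: "fourier \<phi> \<in> L2 lebesgue" by (rule fourier_in_L2[OF \<phi> B cont])
  let ?G = "\<lambda>k \<xi>. complex_of_real (exp (- (inverse (real (Suc k)) * \<xi>)\<^sup>2 / 2))"
  let ?J = "\<lambda>k. \<integral>\<xi>. (cnj (fourier \<phi> \<xi>) * ?G k \<xi>) * fourier f \<xi> \<partial>lebesgue"
  have m: "(\<lambda>\<xi>. fourier f \<xi> * cnj (fourier \<phi> \<xi>)) \<in> borel_measurable lebesgue"
    using L2_mult_integrable[OF Ff F\<phi>] by auto
  have "?J \<longlonglongrightarrow> L2_inner lebesgue (fourier f) (fourier \<phi>)"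
    unfolding L2_inner_def
  proof (rule integral_dominated_convergence)
    show "integrable lebesgue (\<lambda>\<xi>. cmod (fourier f \<xi> * cnj (fourier \<phi> \<xi>)))"
      using L2_mult_integrable[OF Ff F\<phi>] by (rule integrable_norm)
    show "AE \<xi> in lebesgue. (\<lambda>k. cnj (fourier \<phi> \<xi>) * ?G k \<xi> * fourier f \<xi>)
        \<longlonglongrightarrow> fourier f \<xi> * cnj (fourier \<phi> \<xi>)"
    proof (rule AE_I2)
      fix \<xi>
      have "(\<lambda>k. cnj (fourier \<phi> \<xi>) * ?G k \<xi> * fourier f \<xi>) \<longlonglongrightarrow> cnj (fourier \<phi> \<xi>) * 1 * fourier f \<xi>"
        by (intro tendsto_mult tendsto_const gaussian_tendsto_1)
      then show "(\<lambda>k. cnj (fourier \<phi> \<xi>) * ?G k \<xi> * fourier f \<xi>)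
        \<longlonglongrightarrow> fourier f \<xi> * cnj (fourier \<phi> \<xi>)" by (simp add: mult.commute)
    qed
    show "AE \<xi> in lebesgue. cmod (cnj (fourier \<phi> \<xi>) * ?G k \<xi> * fourier f \<xi>)
        \<le> cmod (fourier f \<xi> * cnj (fourier \<phi> \<xi>))" for k
    proof (rule AE_I2)
      fix \<xi>
      have "cmod (?G k \<xi>) * cmod (fourier f \<xi> * cnj (fourier \<phi> \<xi>)) \<le> 1 * cmod (fourier f \<xi> * cnj (fourier \<phi> \<xi>))"
        by (intro mult_right_mono) auto
      then show "cmod (cnj (fourier \<phi> \<xi>) * ?G k \<xi> * fourier f \<xi>)
        \<le> cmod (fourier f \<xi> * cnj (fourier \<phi> \<xi>))"
        by (simp add: norm_mult mult_ac)
    qed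
    show "(\<lambda>\<xi>. cnj (fourier \<phi> \<xi>) * ?G k \<xi> * fourier f \<xi>) \<in> borel_measurable lebesgue" for k
    proof -
      have "(\<lambda>\<xi>. ?G k \<xi> * (fourier f \<xi> * cnj (fourier \<phi> \<xi>))) \<in> borel_measurable lebesgue"
        by (rule borel_measurable_times[OF borel_measurable_lebesgue m]) measurable
      then show ?thesis by (simp add: mult_ac)
    qed
  qed (rule m)
  moreover have "?J \<longlonglongrightarrow> L2_inner lebesgue f \<phi>"
    using gaussian_smoothing_tendsto[OF f \<phi>m B cont] fourier_gaussian_inner[OF f \<phi>]
    by simp
  ultimately show ?thesis by (rule LIMSEQ_unique)
qed

section \<open>Passage to Plancherel transforms of square-integrable functions\<close>

lemma L2_integrable_interval:
  fixes F :: "real \<Rightarrow> complex"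
  assumes "F \<in> L2 lebesgue"
  shows "integrable lebesgue (\<lambda>x. indicator {a..b} x *\<^sub>R F x)"
proof (rule Bochner_Integration.integrable_bound)
  have Fm: "F \<in> borel_measurable lebesgue" using assms by (rule L2_measurable)
  show "integrable lebesgue (\<lambda>x. indicator {a..b} x + (cmod (F x))\<^sup>2 :: real)"
    using L2_integrable[OF assms]
    by (intro Bochner_Integration.integrable_add) (auto simp: emeasure_lborel_Icc_eq)
  show "(\<lambda>x. indicator {a..b} x *\<^sub>R F x) \<in> borel_measurable lebesgue"
    by (intro borel_measurable_scaleR borel_measurable_indicator Fm) simp
  have "t \<le> 1 + t\<^sup>2" if "t \<ge> 0" for t :: real
    using that sum_squares_bound[of t 1] by simp
  then show "AE x in lebesgue. norm (indicator {a..b} x *\<^sub>R F x) \<le> norm (indicator {a..b} x + (cmod (F x))\<^sup>2 :: real)"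
    by (auto simp: indicator_def)
qed

lemma fourier_trunc_eq: "fourier_trunc F R = fourier (\<lambda>x. indicator {-R..R} x *\<^sub>R F x)"
  by (simp add: fourier_trunc_def fourier_def set_lebesgue_integral_def fun_eq_iff)

text \<open>A truncation of \<open>F\<close> that covers the support of \<phi> has the same inner
  product with \<phi> as \<open>F\<close>, and \<open>Plancherel_inner\<close> applies to it. The
  transform of the truncation is close to \<open>G\<close>, so by Cauchy-Schwarz the two sides
  cannot differ by a positive amount.\<close>

lemma has_fourier_L2_inner:
  fixes \<phi> :: "real \<Rightarrow> complex"
  assumes FG: "has_fourier_L2 F G"
    and \<phi>: "integrable lborel \<phi>" and supp: "\<And>x. x \<notin> {-1..1} \<Longrightarrow> \<phi> x = 0"
    and B: "\<And>x. cmod (\<phi> x) \<le> B" and cont: "AE x in lebesgue. isCont \<phi> x"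
  shows "L2_inner lebesgue F \<phi> = L2_inner lebesgue G (fourier \<phi>)"
proof (rule ccontr)
  assume neq: "L2_inner lebesgue F \<phi> \<noteq> L2_inner lebesgue G (fourier \<phi>)"
  have F: "F \<in> L2 lebesgue" and G: "G \<in> L2 lebesgue"
    and lim: "((\<lambda>R. \<integral>\<^sup>+\<xi>. ennreal ((cmod (fourier_trunc F R \<xi> - G \<xi>))\<^sup>2) \<partial>lebesgue) \<longlongrightarrow> 0) at_top"
    using FG by (auto simp: has_fourier_L2_def)
  have F\<phi>: "fourier \<phi> \<in> L2 lebesgue" by (rule fourier_in_L2[OF \<phi> B cont])
  define d where "d = (cmod (L2_inner lebesgue F \<phi> - L2_inner lebesgue G (fourier \<phi>)))\<^sup>2"
  define K where "K = (L2_norm lebesgue (fourier \<phi>))\<^sup>2"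
  have d: "d > 0" using neq by (simp add: d_def)
  have K: "K \<ge> 0" by (simp add: K_def)
  \<comment> \<open>Chosen so that \<open>e * K \<le> d / 2\<close>; the summand 1 covers the case
    \<open>K = 0\<close>.\<close>
  define e where "e = d / (2 * (K + 1))"
  have e: "e > 0" using d K by (simp add: e_def)
  \<comment> \<open>The condition \<open>R \<ge> 1\<close> ensures that the truncation interval
    contains the support of \<phi>.\<close>
  have "eventually (\<lambda>R. (\<integral>\<^sup>+\<xi>. ennreal ((cmod (fourier_trunc F R \<xi> - G \<xi>))\<^sup>2) \<partial>lebesgue) < ennreal e \<and> R \<ge> 1) at_top"
    using order_tendstoD(2)[OF lim, of "ennreal e"] e eventually_ge_at_top[of "1::real"]
    by (simp add: eventually_conj)
  then obtain R where R: "(\<integral>\<^sup>+\<xi>. ennreal ((cmod (fourier_trunc F R \<xi> - G \<xi>))\<^sup>2) \<partial>lebesgue) < ennreal e"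
    and R1: "R \<ge> 1"
    using eventually_happens'[OF trivial_limit_at_top_linorder] by blast
  define T where "T = fourier_trunc F R"
  let ?f = "\<lambda>x. indicator {-R..R} x *\<^sub>R F x"
  have f: "integrable lebesgue ?f" by (rule L2_integrable_interval[OF F])
  have "T \<in> borel_measurable borel"
    unfolding T_def fourier_trunc_eq by (rule fourier_measurable_borel) (use f in auto)
  then have Tm: "T \<in> borel_measurable lebesgue" by (rule borel_measurable_lebesgue)
  have Gm: "G \<in> borel_measurable lebesgue" using G by (rule L2_measurable)
  have Dm: "(\<lambda>\<xi>. T \<xi> - G \<xi>) \<in> borel_measurable lebesgue" using Tm Gm by measurable
  \<comment> \<open>Finiteness of the extended integral for this \<open>R\<close> puts
    \<open>T - G\<close>, and hence \<open>T\<close>, into \<open>L2\<close>.\<close>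
  have Dint: "integrable lebesgue (\<lambda>\<xi>. (cmod (T \<xi> - G \<xi>))\<^sup>2)"
  proof (rule integrableI_nonneg)
    show "(\<integral>\<^sup>+\<xi>. ennreal ((cmod (T \<xi> - G \<xi>))\<^sup>2) \<partial>lebesgue) < \<infinity>"
      using R unfolding T_def by (metis ennreal_less_top infinity_ennreal_def less_trans)
  qed (use Dm in measurable)
  have D: "(\<lambda>\<xi>. T \<xi> - G \<xi>) \<in> L2 lebesgue" using Dm Dint by (simp add: L2_def)
  have "ennreal ((L2_norm lebesgue (\<lambda>\<xi>. T \<xi> - G \<xi>))\<^sup>2) < ennreal e"
    using R Dint unfolding T_def L2_norm_power2 by (simp add: nn_integral_eq_integral)
  then have De: "(L2_norm lebesgue (\<lambda>\<xi>. T \<xi> - G \<xi>))\<^sup>2 \<le> e"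
    using e by (simp add: ennreal_less_iff)
  have T: "T \<in> L2 lebesgue" using L2_add[OF D G] by simp
  have "L2_inner lebesgue T (fourier \<phi>) = L2_inner lebesgue ?f \<phi>"
    unfolding T_def fourier_trunc_eq
    by (rule Plancherel_inner[OF f _ \<phi> B cont]) (use T in \<open>simp add: T_def fourier_trunc_eq\<close>)
  also have "\<dots> = L2_inner lebesgue F \<phi>"
  proof -
    have "?f x * cnj (\<phi> x) = F x * cnj (\<phi> x)" for x
      using R1 supp[of x] by (cases "x \<in> {-1..1}") auto
    then show ?thesis by (simp add: L2_inner_def)
  qed
  finally have "d = (cmod (L2_inner lebesgue (\<lambda>\<xi>. T \<xi> - G \<xi>) (fourier \<phi>)))\<^sup>2"
    by (simp add: d_def L2_inner_diff_left[OF T G F\<phi>])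
  also have "\<dots> \<le> (L2_norm lebesgue (\<lambda>\<xi>. T \<xi> - G \<xi>) * L2_norm lebesgue (fourier \<phi>))\<^sup>2"
    by (intro power_mono L2_Cauchy_Schwarz D F\<phi>) simp
  also have "\<dots> \<le> e * K"
    using De K unfolding power_mult_distrib K_def by (intro mult_right_mono) auto
  also have "\<dots> \<le> d / 2"
    using d K by (simp add: e_def field_simps)
  finally show False using d by simp
qed

section \<open>Truncated Fourier transforms and the sinc operator\<close>

lemma measure_I_meas: "measure I_meas (space I_meas) = 2"
  by (simp add: measure_restrict_space)

text \<open>Cauchy-Schwarz; the factor \<open>sqrt 2\<close> is the square root of the length of the
  interval.\<close>

lemma integral_kernel_bound:
  assumes f: "f \<in> L2 I_meas" and km: "k \<in> borel_measurable I_meas"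
    and B: "\<And>x. x \<in> {-1..1} \<Longrightarrow> cmod (k x) \<le> B" "B \<ge> 0"
  shows "cmod (\<integral>x. f x * k x \<partial>I_meas) \<le> sqrt 2 * B * L2_norm I_meas f"
proof -
  interpret finite_measure I_meas by (rule finite_I_meas)
  let ?k = "\<lambda>x. cnj (k x)"
  have kint: "integrable I_meas (\<lambda>x. (cmod (?k x))\<^sup>2)"
  proof (rule integrable_const_bound[where B = "B\<^sup>2"])
    show "AE x in I_meas. norm ((cmod (?k x))\<^sup>2) \<le> B\<^sup>2"
      using B by (auto intro!: AE_I2 power_mono)
  qed (use km in measurable)
  have kL: "?k \<in> L2 I_meas" using km kint unfolding L2_def by auto
  have "(L2_norm I_meas ?k)\<^sup>2 \<le> (\<integral>x. B\<^sup>2 \<partial>I_meas)"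
    unfolding L2_norm_power2 using kint B by (intro integral_mono) (auto intro!: power_mono)
  also have "\<dots> = (sqrt 2 * B)\<^sup>2" by (simp add: measure_I_meas[simplified] power_mult_distrib)
  finally have "L2_norm I_meas ?k \<le> sqrt 2 * B"
    by (rule power2_le_imp_le) (use B in simp)
  then have "L2_norm I_meas f * L2_norm I_meas ?k \<le> L2_norm I_meas f * (sqrt 2 * B)"
    by (intro mult_left_mono) auto
  then show ?thesis
    using L2_Cauchy_Schwarz[OF f kL] by (simp add: L2_inner_def mult_ac)
qed

lemma L2_I_integrable: "f \<in> L2 I_meas \<Longrightarrow> integrable I_meas f"
proof -
  interpret finite_measure I_meas by (rule finite_I_meas)
  assume f: "f \<in> L2 I_meas"
  then have fm: "f \<in> borel_measurable I_meas" by (rule L2_measurable)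
  have i: "integrable I_meas (\<lambda>x. (cmod (f x))\<^sup>2 + 1)"
    using L2_integrable[OF f] by (intro Bochner_Integration.integrable_add) auto
  have bd: "t \<le> t\<^sup>2 + 1" if "t \<ge> 0" for t :: real
    using that sum_squares_bound[of t 1] by simp
  show ?thesis
  proof (intro Bochner_Integration.integrable_bound[OF i fm] AE_I2)
    fix x
    have "cmod (f x) \<le> (cmod (f x))\<^sup>2 + 1" using bd by simp
    then show "norm (f x) \<le> norm ((cmod (f x))\<^sup>2 + 1)" by simp
  qed
qed

lemma continuous_on_lebesgue_on_measurable:
  fixes h :: "real \<Rightarrow> 'b::euclidean_space"
  assumes "continuous_on UNIV h"
  shows "h \<in> borel_measurable (lebesgue_on A)"
  using measurable_compose[OF id_lebesgue_on borel_measurable_continuous_onI[OF assms]] .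

lemma integrable_continuous_Icc:
  fixes h :: "real \<Rightarrow> 'b::euclidean_space"
  assumes "continuous_on UNIV h"
  shows "integrable (lebesgue_on {a..b}) h"
  using continuous_imp_integrable[of a b h] continuous_on_subset[OF assms] by simp

section \<open>The Fourier integral over the interval\<close>

text \<open>For \<open>f = \<psi> n\<close> this is the function \<open>h\<^sub>n\<close> of the
  introduction: the Fourier transform of \<open>f\<close> extended by zero, without the factor
  \<open>1 / sqrt (2 * pi)\<close>.\<close>

definition osc :: "(real \<Rightarrow> complex) \<Rightarrow> real \<Rightarrow> complex" where
  "osc f \<xi> = (\<integral>y. f y * cis (- (y * \<xi>)) \<partial>I_meas)"

lemma osc_bound:
  assumes "f \<in> L2 I_meas"
  shows "cmod (osc f \<xi>) \<le> sqrt 2 * L2_norm I_meas f"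
proof -
  have "(\<lambda>y. cis (- (y * \<xi>))) \<in> borel_measurable I_meas"
    by (intro continuous_on_lebesgue_on_measurable continuous_intros)
  then show ?thesis
    using integral_kernel_bound[OF assms, of "\<lambda>y. cis (- (y * \<xi>))" 1] by (simp add: osc_def)
qed

lemma norm_cis_diff: "cmod (cis a - cis b) \<le> \<bar>a - b\<bar>"
proof -
  have "cmod (cis (a - b) - 1) \<le> \<bar>a - b\<bar>"
    using iexp_approx1[of "a - b" 0] by (simp add: cis_conv_exp)
  moreover have "cis a - cis b = cis b * (cis (a - b) - 1)"
    by (simp add: right_diff_distrib cis_mult)
  ultimately show ?thesis by (simp add: norm_mult)
qed

lemma integrable_mult_cis:
  assumes "integrable M f" "(\<lambda>x. x) \<in> borel_measurable M"
  shows "integrable M (\<lambda>y. f y * cis (a * y))"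
proof (rule Bochner_Integration.integrable_bound[OF assms(1)])
  have "(\<lambda>y. cis (a * y)) \<in> borel_measurable M"
    by (rule measurable_compose[OF assms(2)]) measurable
  then show "(\<lambda>y. f y * cis (a * y)) \<in> borel_measurable M"
    using assms(1) by auto
qed (simp add: norm_mult)

text \<open>The derivative of the exponential in its frequency is bounded by
  \<open>\<bar>y\<bar> \<le> 1\<close> on the interval.\<close>

lemma osc_Lipschitz:
  assumes f: "f \<in> L2 I_meas"
  shows "cmod (osc f s - osc f t) \<le> sqrt 2 * L2_norm I_meas f * \<bar>s - t\<bar>"
proof -
  have i: "integrable I_meas (\<lambda>y. f y * cis (- (y * \<xi>)))" for \<xi>
    using integrable_mult_cis[OF L2_I_integrable[OF f] id_lebesgue_on, of "-\<xi>"]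
    by (simp add: mult.commute)
  have "osc f s - osc f t = (\<integral>y. f y * (cis (- (y * s)) - cis (- (y * t))) \<partial>I_meas)"
    unfolding osc_def by (simp add: right_diff_distrib i)
  also have "cmod \<dots> \<le> sqrt 2 * \<bar>s - t\<bar> * L2_norm I_meas f"
  proof (rule integral_kernel_bound[OF f])
    show "cmod (cis (- (y * s)) - cis (- (y * t))) \<le> \<bar>s - t\<bar>" if "y \<in> {-1..1}" for y
    proof -
      have "cmod (cis (- (y * s)) - cis (- (y * t))) \<le> \<bar>y\<bar> * \<bar>s - t\<bar>"
        using norm_cis_diff[of "- (y * s)" "- (y * t)"]
        by (simp add: abs_mult[symmetric] algebra_simps abs_minus_commute)
      also have "\<dots> \<le> 1 * \<bar>s - t\<bar>" using that by (intro mult_right_mono) auto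
      finally show ?thesis by simp
    qed
  qed (auto intro!: continuous_on_lebesgue_on_measurable continuous_intros)
  finally show ?thesis by (simp add: mult_ac)
qed

lemma osc_continuous:
  assumes f: "f \<in> L2 I_meas"
  shows "continuous_on UNIV (osc f)"
proof (rule lipschitz_on_continuous_on)
  show "(sqrt 2 * L2_norm I_meas f)-lipschitz_on UNIV (osc f)"
    by (rule lipschitz_onI) (use osc_Lipschitz[OF f] in \<open>auto simp: dist_norm\<close>)
qed

section \<open>Factorisation of the sinc operator through the band\<close>

lemma integral_cis_Icc:
  assumes "u \<noteq> 0" "c \<ge> 0"
  shows "(\<integral>t. cis (u * t) \<partial>lebesgue_on {-c..c}) = complex_of_real (2 * sin (c * u) / u)"
proof -
  have "((\<lambda>t. cis (u * t)) has_integral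
      (cis (u * c) / (\<i> * of_real u) - cis (u * (-c)) / (\<i> * of_real u))) {-c..c}"
  proof (rule fundamental_theorem_of_calculus)
    fix t assume "t \<in> {-c..c}"
    show "((\<lambda>t. cis (u * t) / (\<i> * of_real u)) has_vector_derivative cis (u * t)) (at t within {-c..c})"
      using assms unfolding has_vector_derivative_def
      by (auto intro!: derivative_eq_intros simp: scaleR_conv_of_real field_simps)
  qed (use assms in auto)
  moreover have "cis (u * c) / (\<i> * of_real u) - cis (u * (-c)) / (\<i> * of_real u)
      = complex_of_real (2 * sin (c * u) / u)"
    using assms by (auto simp: complex_eq_iff field_simps Re_divide Im_divide power2_eq_square)
  ultimately have "integral {-c..c} (\<lambda>t. cis (u * t)) = complex_of_real (2 * sin (c * u) / u)"
    by (simp add: integral_unique)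
  moreover have "integrable (lebesgue_on {-c..c}) (\<lambda>t. cis (u * t))"
    by (rule integrable_continuous_Icc) (intro continuous_intros)
  ultimately show ?thesis by (simp add: lebesgue_integral_eq_integral)
qed

lemma sigma_finite_lebesgue_on_Icc: "sigma_finite_measure (lebesgue_on {a..b::real})"
  by (rule sigma_finite_measure_restrict_space[OF sigma_finite_lebesgue]) simp

text \<open>The sinc kernel is, up to \<open>1 / (2 * pi)\<close>, the integral of
  \<open>cis ((x - y) * t)\<close> over \<open>{-c..c}\<close>; exchanging integrals produces
  \<open>osc f\<close>. The diagonal \<open>y = x\<close>, where the formula fails, is a null
  set.\<close>

lemma sinc_op_eq:
  assumes f: "f \<in> L2 I_meas" and c: "c > 0"
  shows "sinc_op c f x = complex_of_real (1 / (2 * pi)) * (\<integral>t. osc f t * cis (x * t) \<partial>lebesgue_on {-c..c})"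
proof -
  have fi: "integrable I_meas f" by (rule L2_I_integrable[OF f])
  have "(\<integral>t. osc f t * cis (x * t) \<partial>lebesgue_on {-c..c})
      = (\<integral>t. cis (x * t) * (\<integral>y. f y * cis (- (y * t)) \<partial>I_meas) \<partial>lebesgue_on {-c..c})"
    by (simp add: osc_def mult.commute)
  also have "\<dots> = (\<integral>y. f y * (\<integral>t. cis (x * t) * cis (- (y * t)) \<partial>lebesgue_on {-c..c}) \<partial>I_meas)"
  proof (rule Fubini_bounded_kernel(2)[where B = 1])
    show "integrable (lebesgue_on {-c..c}) (\<lambda>t. cis (x * t))"
      by (rule integrable_continuous_Icc) (intro continuous_intros)
  qed (auto simp: case_prod_beta intro!: fi sigma_finite_lebesgue_on_Icc
      continuous_on_measurable_pair continuous_intros id_lebesgue_on)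
  also have "\<dots> = (\<integral>y. complex_of_real (2 * pi) * (complex_of_real (sin (c * (x - y)) / (pi * (x - y))) * f y) \<partial>I_meas)"
  proof (rule integral_cong_AE)
    have fm: "f \<in> borel_measurable I_meas" using fi by auto
    have eq: "f y * (\<integral>t. cis (x * t) * cis (- (y * t)) \<partial>lebesgue_on {-c..c})
        = complex_of_real (2 * pi) * (complex_of_real (sin (c * (x - y)) / (pi * (x - y))) * f y)" if "y \<noteq> x" for y
    proof -
      have "(\<lambda>t. cis (x * t) * cis (- (y * t))) = (\<lambda>t. cis ((x - y) * t))"
        by (simp add: cis_mult algebra_simps)
      then show ?thesis using that c integral_cis_Icc[of "x - y" c] by simp
    qed
    have "AE y in lebesgue. y \<noteq> x"
      by (rule AE_completion) (rule AE_lborel_singleton)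
    then have "AE y in I_meas. y \<noteq> x"
      by (auto simp: AE_restrict_space_iff elim: eventually_mono)
    then show "AE y in I_meas. f y * (\<integral>t. cis (x * t) * cis (- (y * t)) \<partial>lebesgue_on {-c..c})
        = complex_of_real (2 * pi) * (complex_of_real (sin (c * (x - y)) / (pi * (x - y))) * f y)"
      using eq by auto
    have "(\<lambda>y. complex_of_real (sin (c * (x - y)) / (pi * (x - y)))) \<in> borel_measurable I_meas"
      by (rule measurable_compose[OF id_lebesgue_on]) measurable
    then show "(\<lambda>y. complex_of_real (2 * pi) * (complex_of_real (sin (c * (x - y)) / (pi * (x - y))) * f y)) \<in> borel_measurable I_meas"
      using fm by (intro borel_measurable_times) auto
    interpret sigma_finite_measure "lebesgue_on {-c..c}" by (rule sigma_finite_lebesgue_on_Icc)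
    have "(\<lambda>z. cis (x * snd z) * cis (- (fst z * snd z))) \<in> borel_measurable (I_meas \<Otimes>\<^sub>M lebesgue_on {-c..c})"
      by (intro continuous_on_measurable_pair continuous_intros id_lebesgue_on)
    then have "(\<lambda>y. \<integral>t. cis (x * t) * cis (- (y * t)) \<partial>lebesgue_on {-c..c}) \<in> borel_measurable I_meas"
      by (intro borel_measurable_lebesgue_integral) (simp add: case_prod_beta)
    then show "(\<lambda>y. f y * (\<integral>t. cis (x * t) * cis (- (y * t)) \<partial>lebesgue_on {-c..c})) \<in> borel_measurable I_meas"
      using fm by (intro borel_measurable_times)
  qed
  also have "\<dots> = complex_of_real (2 * pi) * sinc_op c f x"
    unfolding sinc_op_def by (rule integral_mult_right_zero)
  finally show ?thesis by simp
qed

lemma sinc_op_bounded: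
  assumes f: "f \<in> L2 I_meas" and c: "c > 0"
  shows "\<exists>B. \<forall>x. cmod (sinc_op c f x) \<le> B"
proof (intro exI allI)
  fix x
  have "cmod (\<integral>t. osc f t * cis (x * t) \<partial>lebesgue_on {-c..c}) \<le> (\<integral>t. cmod (osc f t) \<partial>lebesgue_on {-c..c})"
    using integral_norm_bound[of "lebesgue_on {-c..c}" "\<lambda>t. osc f t * cis (x * t)"] by (simp add: norm_mult)
  then show "cmod (sinc_op c f x) \<le> cmod (complex_of_real (1 / (2 * pi))) * (\<integral>t. cmod (osc f t) \<partial>lebesgue_on {-c..c})"
    unfolding sinc_op_eq[OF f c] norm_mult by (rule mult_left_mono) simp
qed

text \<open>Frequencies bounded by \<open>c\<close> give a Lipschitz function of \<open>x\<close>.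
  Through the eigenvalue equation this supplies continuous representatives of the
  eigenfunctions.\<close>

lemma sinc_op_continuous:
  assumes f: "f \<in> L2 I_meas" and c: "c > 0"
  shows "continuous_on UNIV (sinc_op c f)"
proof -
  let ?M = "lebesgue_on {-c..c}" and ?S = "\<lambda>x. \<integral>t. osc f t * cis (x * t) \<partial>lebesgue_on {-c..c}"
  have i: "integrable ?M (\<lambda>t. osc f t * cis (x * t))" for x
    by (intro integrable_continuous_Icc continuous_intros osc_continuous[OF f])
  have ic: "integrable ?M (\<lambda>t. c * cmod (osc f t))"
    by (intro integrable_continuous_Icc continuous_intros osc_continuous[OF f])
  have "continuous_on UNIV ?S"
  proof (rule lipschitz_on_continuous_on)
    show "(\<integral>t. c * cmod (osc f t) \<partial>?M)-lipschitz_on UNIV ?S"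
    proof (rule lipschitz_onI)
      fix x y :: real
      have "?S x - ?S y = (\<integral>t. osc f t * cis (x * t) - osc f t * cis (y * t) \<partial>?M)"
        by (simp add: i)
      also have "cmod \<dots> \<le> (\<integral>t. c * cmod (osc f t) * \<bar>x - y\<bar> \<partial>?M)"
      proof (rule Bochner_Integration.integral_norm_bound_integral)
        fix t assume "t \<in> space ?M"
        then have t: "\<bar>t\<bar> \<le> c" by auto
        have "cmod (cis (x * t) - cis (y * t)) \<le> \<bar>t\<bar> * \<bar>x - y\<bar>"
          using norm_cis_diff[of "x * t" "y * t"] by (simp add: abs_mult[symmetric] algebra_simps)
        also have "\<dots> \<le> c * \<bar>x - y\<bar>" using t by (intro mult_right_mono) auto
        finally have "cmod (osc f t) * cmod (cis (x * t) - cis (y * t)) \<le> cmod (osc f t) * (c * \<bar>x - y\<bar>)"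
          by (rule mult_left_mono) simp
        then show "norm (osc f t * cis (x * t) - osc f t * cis (y * t)) \<le> c * cmod (osc f t) * \<bar>x - y\<bar>"
          by (simp add: norm_mult mult_ac flip: right_diff_distrib)
      qed (use i ic in auto)
      finally show "dist (?S x) (?S y) \<le> (\<integral>t. c * cmod (osc f t) \<partial>?M) * dist x y"
        by (simp add: dist_norm)
    qed (use c in \<open>auto intro!: integral_nonneg\<close>)
  qed
  then have "continuous_on UNIV (\<lambda>x. complex_of_real (1 / (2 * pi)) * ?S x)"
    by (intro continuous_intros)
  then show ?thesis
    using sinc_op_eq[OF f c] by simp
qed

text \<open>In operator terms, \<open>sinc_op\<close> is \<open>1 / (2 * pi)\<close> times the
  adjoint of \<open>osc\<close>, restricted to the band \<open>{-c..c}\<close>, composed with that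
  restriction.\<close>

lemma osc_inner:
  assumes f: "f \<in> L2 I_meas" and g: "g \<in> L2 I_meas" and c: "c > 0"
  shows "(\<integral>t. osc f t * cnj (osc g t) \<partial>lebesgue_on {-c..c})
    = complex_of_real (2 * pi) * (\<integral>x. cnj (g x) * sinc_op c f x \<partial>I_meas)"
proof -
  have gi: "integrable I_meas (\<lambda>x. cnj (g x))" using L2_I_integrable[OF g] by simp
  have "(\<integral>t. osc f t * cnj (osc g t) \<partial>lebesgue_on {-c..c})
    = (\<integral>t. osc f t * (\<integral>x. cnj (g x) * cis (x * t) \<partial>I_meas) \<partial>lebesgue_on {-c..c})"
    unfolding osc_def by (subst Bochner_Integration.integral_cnj[symmetric]) (simp add: cis_cnj)
  also have "\<dots> = (\<integral>x. cnj (g x) * (\<integral>t. osc f t * cis (x * t) \<partial>lebesgue_on {-c..c}) \<partial>I_meas)"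
  proof (rule Fubini_bounded_kernel(2)[where B = 1])
    show "integrable (lebesgue_on {-c..c}) (osc f)"
      by (rule integrable_continuous_Icc[OF osc_continuous[OF f]])
  qed (auto simp: case_prod_beta intro!: gi[simplified] sigma_finite_lebesgue_on_Icc
      continuous_on_measurable_pair continuous_intros id_lebesgue_on)
  also have "\<dots> = (\<integral>x. complex_of_real (2 * pi) * (cnj (g x) * sinc_op c f x) \<partial>I_meas)"
    by (intro Bochner_Integration.integral_cong refl) (simp add: sinc_op_eq[OF f c])
  finally show ?thesis by simp
qed

section \<open>Decay of the Fourier transforms of the eigenfunctions\<close>

text \<open>Gaussian elimination, by induction on the number of equations: the index
  \<open>i\<close> counts the \<open>n + 1\<close> unknowns and \<open>j\<close> the
  \<open>n\<close> equations.\<close>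

lemma underdetermined_system:
  fixes m :: "nat \<Rightarrow> nat \<Rightarrow> 'a::field"
  shows "\<exists>a. (\<exists>i\<le>n. a i \<noteq> 0) \<and> (\<forall>j<n. (\<Sum>i\<le>n. a i * m i j) = 0)"
proof (induction n arbitrary: m)
  case 0
  show ?case by (intro exI[of _ "\<lambda>_. 1"]) simp
next
  case (Suc n)
  show ?case
  proof (cases "\<exists>p\<le>Suc n. m p n \<noteq> 0")
    \<comment> \<open>The last equation is void, so the induction hypothesis for the other unknowns
      suffices and the last unknown is set to 0.\<close>
    case False
    obtain a where a: "\<exists>i\<le>n. a i \<noteq> 0" "\<forall>j<n. (\<Sum>i\<le>n. a i * m i j) = 0"
      using Suc by blast
    show ?thesis
    proof (intro exI[of _ "\<lambda>i. if i \<le> n then a i else 0"] conjI allI impI)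
      show "\<exists>i\<le>Suc n. (if i \<le> n then a i else 0) \<noteq> 0" using a(1) by force
      fix j assume j: "j < Suc n"
      have "(\<Sum>i\<le>Suc n. (if i \<le> n then a i else 0) * m i j) = (\<Sum>i\<le>n. a i * m i j)"
        by simp
      also have "\<dots> = 0"
        using a(2) False j by (cases "j < n") (simp_all add: less_Suc_eq)
      finally show "(\<Sum>i\<le>Suc n. (if i \<le> n then a i else 0) * m i j) = 0" .
    qed
  next
    case True
    then obtain p where p: "p \<le> Suc n" "m p n \<noteq> 0" by blast
    \<comment> \<open>\<open>q\<close> enumerates the unknowns other than the pivot
      \<open>p\<close>; \<open>m'\<close> is the system left after eliminating unknown
      \<open>p\<close> with the help of equation \<open>n\<close>.\<close>
    define q where "q i = (if i < p then i else Suc i)" for i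
    have q: "bij_betw q {..n} ({..Suc n} - {p})"
      by (rule bij_betw_byWitness[where f' = "\<lambda>i. if i < p then i else i - 1"])
        (use p in \<open>auto simp: q_def\<close>)
    define m' where "m' i j = m (q i) j - m (q i) n / m p n * m p j" for i j
    obtain b where b: "\<exists>i\<le>n. b i \<noteq> 0" "\<forall>j<n. (\<Sum>i\<le>n. b i * m' i j) = 0"
      using Suc[of m'] by blast
    define b' where "b' = b \<circ> the_inv_into {..n} q"
    have b'q: "b' (q i) = b i" if "i \<le> n" for i
      using q that by (simp add: b'_def bij_betw_def the_inv_into_f_f)
    \<comment> \<open>The value at \<open>p\<close> solves equation \<open>n\<close> for the
      eliminated unknown.\<close>
    define a where "a i = (if i = p then - (\<Sum>i\<le>n. b i * (m (q i) n / m p n)) else b' i)" for i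
    have aq: "a (q i) = b i" if "i \<le> n" for i
      using b'q[OF that] by (auto simp: a_def q_def split: if_splits)
    have sum: "(\<Sum>i\<le>Suc n. a i * m i j) = (\<Sum>i\<le>n. b i * m' i j)" for j
    proof -
      have "(\<Sum>i\<le>Suc n. a i * m i j) = a p * m p j + (\<Sum>i\<in>{..Suc n} - {p}. a i * m i j)"
        using p by (intro sum.remove) auto
      also have "(\<Sum>i\<in>{..Suc n} - {p}. a i * m i j) = (\<Sum>i\<le>n. b i * m (q i) j)"
        by (subst sum.reindex_bij_betw[OF q, symmetric]) (simp add: aq)
      finally show ?thesis
        by (simp add: a_def m'_def right_diff_distrib sum_subtractf sum_distrib_right mult.assoc)
    qed
    show ?thesis
    proof (intro exI[of _ a] conjI allI impI)
      obtain i where "i \<le> n" "b i \<noteq> 0" using b by blast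
      then show "\<exists>i\<le>Suc n. a i \<noteq> 0"
        using q aq[of i] by (intro exI[of _ "q i"]) (auto simp: bij_betw_def)
      fix j assume "j < Suc n"
      then show "(\<Sum>i\<le>Suc n. a i * m i j) = 0"
        unfolding sum using b(2) p by (cases "j = n") (auto simp: m'_def less_Suc_eq)
    qed
  qed
qed

section \<open>Orthogonality of the transforms on the band\<close>

locale pswf_basis =
  fixes c :: real and \<mu> :: "nat \<Rightarrow> real" and \<psi> :: "nat \<Rightarrow> real \<Rightarrow> complex"
  assumes c: "c \<ge> 1" and pswf: "pswf c \<mu> \<psi>"
begin

lemma orthonormal: "L2_orthonormal I_meas \<psi>"
  using pswf by (simp add: pswf_def orthonormal_basis_I_def L2_orthonormal_def)

lemma \<psi>_L2: "\<psi> n \<in> L2 I_meas"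
  using orthonormal by (simp add: L2_orthonormal_def)

lemma \<psi>_norm [simp]: "L2_norm I_meas (\<psi> n) = 1"
proof -
  have "complex_of_real ((L2_norm I_meas (\<psi> n))\<^sup>2) = complex_of_real 1"
    using orthonormal L2_inner_self[of I_meas "\<psi> n"] by (simp add: L2_orthonormal_def)
  then have "(L2_norm I_meas (\<psi> n))\<^sup>2 = 1"
    by (simp only: of_real_eq_iff)
  then show ?thesis
    using L2_norm_nonneg[of I_meas "\<psi> n"] by (simp add: power2_eq_1_iff)
qed

lemma \<mu>_pos: "0 < \<mu> n"
  using pswf by (simp add: pswf_def)

lemma \<mu>_decreasing: "m \<le> n \<Longrightarrow> \<mu> n \<le> \<mu> m"
proof (rule lift_Suc_antimono_le[of \<mu>])
  show "\<mu> (Suc k) \<le> \<mu> k" for k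
    using pswf unfolding pswf_def by (blast intro: less_imp_le)
qed

lemma eigenfunction: "AE x in I_meas. sinc_op c (\<psi> n) x = complex_of_real (\<mu> n) * \<psi> n x"
  using pswf by (simp add: pswf_def)

text \<open>\<open>osc_inner\<close> reduces the integral to the inner product of
  \<open>sinc_op c (\<psi> i)\<close> with \<open>\<psi> j\<close>, where the eigenvalue equation
  applies.\<close>

lemma osc_orthogonal:
  "(\<integral>t. osc (\<psi> i) t * cnj (osc (\<psi> j) t) \<partial>lebesgue_on {-c..c})
    = (if i = j then complex_of_real (2 * pi * \<mu> i) else 0)"
proof -
  have c0: "c > 0" using c by simp
  have "(\<integral>x. cnj (\<psi> j x) * sinc_op c (\<psi> i) x \<partial>I_meas)
      = (\<integral>x. complex_of_real (\<mu> i) * (\<psi> i x * cnj (\<psi> j x)) \<partial>I_meas)"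
  proof (rule integral_cong_AE)
    have m: "\<psi> n \<in> borel_measurable I_meas" for n by (rule L2_measurable[OF \<psi>_L2])
    show "(\<lambda>x. cnj (\<psi> j x) * sinc_op c (\<psi> i) x) \<in> borel_measurable I_meas"
      using m by (intro borel_measurable_times borel_measurable_cnj
          continuous_on_lebesgue_on_measurable[OF sinc_op_continuous[OF \<psi>_L2 c0]])
    show "(\<lambda>x. complex_of_real (\<mu> i) * (\<psi> i x * cnj (\<psi> j x))) \<in> borel_measurable I_meas"
      using m by (intro borel_measurable_times borel_measurable_cnj) auto
    show "AE x in I_meas. cnj (\<psi> j x) * sinc_op c (\<psi> i) x = complex_of_real (\<mu> i) * (\<psi> i x * cnj (\<psi> j x))"
      using eigenfunction[of i] by eventually_elim simp
  qed
  also have "\<dots> = complex_of_real (\<mu> i) * L2_inner I_meas (\<psi> i) (\<psi> j)"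
    by (simp add: L2_inner_def)
  finally show ?thesis
    using osc_inner[OF \<psi>_L2 \<psi>_L2 c0, of i j] orthonormal by (simp add: L2_orthonormal_def)
qed

lemma osc_integrable: "integrable (lebesgue_on {a..b}) (\<lambda>t. osc (\<psi> i) t * cnj (osc (\<psi> j) t))"
  by (intro integrable_continuous_Icc continuous_intros osc_continuous \<psi>_L2)

lemma osc_norm: "(\<integral>t. (cmod (osc (\<psi> n) t))\<^sup>2 \<partial>lebesgue_on {-c..c}) = 2 * pi * \<mu> n"
proof -
  have "complex_of_real (\<integral>t. (cmod (osc (\<psi> n) t))\<^sup>2 \<partial>lebesgue_on {-c..c}) = complex_of_real (2 * pi * \<mu> n)"
    using osc_orthogonal[of n n]
    by (simp add: complex_norm_square[symmetric] del: of_real_power flip: integral_complex_of_real)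
  then show ?thesis by (simp only: of_real_eq_iff)
qed

lemma osc_combination_norm:
  "(\<integral>t. (cmod (\<Sum>i\<le>n. a i * osc (\<psi> i) t))\<^sup>2 \<partial>lebesgue_on {-c..c})
    = (\<Sum>i\<le>n. (cmod (a i))\<^sup>2 * (2 * pi * \<mu> i))"
proof -
  have "complex_of_real (\<integral>t. (cmod (\<Sum>i\<le>n. a i * osc (\<psi> i) t))\<^sup>2 \<partial>lebesgue_on {-c..c})
    = (\<integral>t. (\<Sum>i\<le>n. \<Sum>j\<le>n. a i * cnj (a j) * (osc (\<psi> i) t * cnj (osc (\<psi> j) t))) \<partial>lebesgue_on {-c..c})"
    unfolding integral_complex_of_real[symmetric] complex_norm_square cnj_sum complex_cnj_mult sum_product
    by (simp add: mult_ac)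
  also have "\<dots> = (\<Sum>i\<le>n. \<Sum>j\<le>n. a i * cnj (a j) * (\<integral>t. osc (\<psi> i) t * cnj (osc (\<psi> j) t) \<partial>lebesgue_on {-c..c}))"
    by (simp add: Bochner_Integration.integral_sum osc_integrable)
  also have "\<dots> = (\<Sum>i\<le>n. a i * cnj (a i) * complex_of_real (2 * pi * \<mu> i))"
    unfolding osc_orthogonal by (simp add: if_distrib cong: if_cong)
  also have "\<dots> = complex_of_real (\<Sum>i\<le>n. (cmod (a i))\<^sup>2 * (2 * pi * \<mu> i))"
    unfolding complex_norm_square[symmetric] by simp
  finally show ?thesis by (simp only: of_real_eq_iff)
qed

end

section \<open>Taylor remainders and extrapolation beyond the band\<close>

lemma norm_cis_Taylor: "cmod (cis x - (\<Sum>j<n. (\<i> * of_real x) ^ j / fact j)) \<le> \<bar>x\<bar> ^ n / fact n"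
proof (cases n)
  case (Suc k)
  then show ?thesis
    using iexp_approx1[of x k] by (simp add: cis_conv_exp lessThan_Suc_atMost)
qed simp

lemma L2_I_integrable_mult:
  fixes h :: "real \<Rightarrow> complex"
  assumes f: "f \<in> L2 I_meas" and h: "continuous_on UNIV h"
  shows "integrable I_meas (\<lambda>y. f y * h y)"
proof -
  have fi: "integrable I_meas f" by (rule L2_I_integrable[OF f])
  have "compact (h ` {-1..1})"
    by (intro compact_continuous_image continuous_on_subset[OF h]) auto
  then obtain B where B: "\<And>y. y \<in> {-1..1} \<Longrightarrow> cmod (h y) \<le> B"
    using compact_imp_bounded bounded_iff by (metis imageI)
  have b0: "B \<ge> 0" using B[of 0] norm_ge_zero[of "h 0"] by (simp del: norm_ge_zero)
  show ?thesis
  proof (rule Bochner_Integration.integrable_bound)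
    show "integrable I_meas (\<lambda>y. B * cmod (f y))" using fi by simp
    show "(\<lambda>y. f y * h y) \<in> borel_measurable I_meas"
      by (intro borel_measurable_times continuous_on_lebesgue_on_measurable[OF h] borel_measurable_integrable[OF fi])
    show "AE y in I_meas. norm (f y * h y) \<le> norm (B * cmod (f y))"
    proof (rule AE_I2)
      fix y assume "y \<in> space I_meas"
      then have "cmod (h y) * cmod (f y) \<le> B * cmod (f y)"
        using B[of y] by (intro mult_right_mono) auto
      then show "norm (f y * h y) \<le> norm (B * cmod (f y))"
        using b0 by (simp add: norm_mult mult.commute)
    qed
  qed
qed

text \<open>With \<open>h = \<xi> / K\<close> and \<open>z y = cis (- (y * h)) - 1\<close>, the
  exponential is \<open>(1 + z y) ^ K\<close>. Integrating \<open>f\<close> against a low power of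
  \<open>z\<close> involves only values of \<open>osc f\<close> at multiples of \<open>h\<close>
  inside the band; high powers are small pointwise because \<open>z\<close> is at most
  \<open>\<bar>h\<bar>\<close>.\<close>

lemma osc_extrapolation:
  assumes f: "f \<in> L2 I_meas" and \<eta>: "\<And>t. \<bar>t\<bar> \<le> c \<Longrightarrow> cmod (osc f t) \<le> \<eta>"
    and K: "K > 0" and m: "m \<le> K" "real m * \<bar>\<xi>\<bar> \<le> real K * c"
  shows "cmod (osc f \<xi>) \<le> (\<Sum>j<m. real (K choose j) * 2 ^ j * \<eta>)
    + sqrt 2 * (\<Sum>j=m..K. \<bar>\<xi>\<bar> ^ j / fact j) * L2_norm I_meas f"
proof -
  define h where "h = \<xi> / real K"
  define z where "z y = cis (- (y * h)) - 1" for y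
  have zc: "continuous_on UNIV z" unfolding z_def by (intro continuous_intros)
  have z_le: "cmod (z y) \<le> \<bar>h\<bar>" if "y \<in> {-1..1}" for y
  proof -
    have "cmod (z y) \<le> \<bar>y\<bar> * \<bar>h\<bar>"
      using norm_cis_diff[of "- (y * h)" 0] by (simp add: z_def abs_mult)
    also have "\<dots> \<le> 1 * \<bar>h\<bar>" using that by (intro mult_right_mono) auto
    finally show ?thesis by simp
  qed
  have cis: "cis (- (y * \<xi>)) = (\<Sum>j<m. of_nat (K choose j) * z y ^ j) + (\<Sum>j=m..K. of_nat (K choose j) * z y ^ j)" for y
  proof -
    have "real K * (- (y * h)) = - (y * \<xi>)"
      using K by (simp add: h_def)
    then have "cis (- (y * \<xi>)) = cis (- (y * h)) ^ K"
      by (simp only: Complex.DeMoivre)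
    also have "\<dots> = (z y + 1) ^ K" by (simp add: z_def)
    also have "\<dots> = (\<Sum>j\<le>K. of_nat (K choose j) * z y ^ j)"
      by (simp add: binomial_ring)
    also have "{..K} = {..<m} \<union> {m..K}" using m by auto
    also have "(\<Sum>j\<in>{..<m} \<union> {m..K}. of_nat (K choose j) * z y ^ j)
        = (\<Sum>j<m. of_nat (K choose j) * z y ^ j) + (\<Sum>j=m..K. of_nat (K choose j) * z y ^ j)"
      by (rule sum.union_disjoint) auto
    finally show ?thesis .
  qed
  \<comment> \<open>Expanding \<open>z y ^ j\<close> gives \<open>osc f\<close> at
    \<open>i * h\<close> for \<open>i \<le> j\<close>, with binomial weights of total mass
    \<open>2 ^ j\<close>. As \<open>j < m\<close>, these frequencies stay in
    \<open>{-c..c}\<close>.\<close>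
  have moment: "cmod (\<integral>y. f y * z y ^ j \<partial>I_meas) \<le> 2 ^ j * \<eta>" if "j < m" for j
  proof -
    have "(\<integral>y. f y * z y ^ j \<partial>I_meas)
      = (\<integral>y. (\<Sum>i\<le>j. of_nat (j choose i) * (- 1) ^ (j - i) * (f y * cis (- (y * (real i * h))))) \<partial>I_meas)"
    proof (intro Bochner_Integration.integral_cong refl)
      fix y
      have "z y ^ j = (\<Sum>i\<le>j. of_nat (j choose i) * cis (- (y * h)) ^ i * (- 1) ^ (j - i))"
        unfolding z_def diff_conv_add_uminus by (rule binomial_ring)
      also have "\<dots> = (\<Sum>i\<le>j. of_nat (j choose i) * (- 1) ^ (j - i) * cis (- (y * (real i * h))))"
        by (intro sum.cong refl) (simp add: Complex.DeMoivre mult_ac)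
      finally show "f y * z y ^ j
        = (\<Sum>i\<le>j. of_nat (j choose i) * (- 1) ^ (j - i) * (f y * cis (- (y * (real i * h)))))"
        by (simp add: sum_distrib_left mult_ac)
    qed
    also have "\<dots> = (\<Sum>i\<le>j. of_nat (j choose i) * (- 1) ^ (j - i) * osc f (real i * h))"
    proof -
      have "integrable I_meas (\<lambda>y. f y * cis (- (y * (real i * h))))" for i
        by (intro L2_I_integrable_mult[OF f] continuous_intros)
      then show ?thesis
        by (simp add: osc_def Bochner_Integration.integral_sum del: mult_minus_right)
    qed
    also have "cmod \<dots> \<le> (\<Sum>i\<le>j. real (j choose i) * \<eta>)"
    proof (rule sum_norm_le)
      fix i assume "i \<in> {..j}"
      then have "real i * \<bar>\<xi>\<bar> \<le> real m * \<bar>\<xi>\<bar>" using that by (intro mult_right_mono) auto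
      also have "\<dots> \<le> real K * c" by (rule m)
      finally have "\<bar>real i * h\<bar> \<le> c" using K by (simp add: h_def abs_mult divide_simps mult.commute)
      then have "cmod (osc f (real i * h)) \<le> \<eta>" by (rule \<eta>)
      then show "cmod (of_nat (j choose i) * (- 1) ^ (j - i) * osc f (real i * h)) \<le> real (j choose i) * \<eta>"
        by (simp add: norm_mult norm_power mult_left_mono)
    qed
    also have "\<dots> = real (\<Sum>i\<le>j. j choose i) * \<eta>"
      by (simp add: sum_distrib_right)
    also have "\<dots> = 2 ^ j * \<eta>" by (simp only: choose_row_sum) simp
    finally show ?thesis .
  qed
  have "osc f \<xi> = (\<integral>y. (\<Sum>j<m. of_nat (K choose j) * (f y * z y ^ j)) + f y * (\<Sum>j=m..K. of_nat (K choose j) * z y ^ j) \<partial>I_meas)"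
    unfolding osc_def cis by (intro Bochner_Integration.integral_cong refl)
      (simp add: distrib_left sum_distrib_left mult_ac)
  also have "\<dots> = (\<Sum>j<m. of_nat (K choose j) * (\<integral>y. f y * z y ^ j \<partial>I_meas))
      + (\<integral>y. f y * (\<Sum>j=m..K. of_nat (K choose j) * z y ^ j) \<partial>I_meas)"
  proof -
    have 1: "integrable I_meas (\<lambda>y. f y * z y ^ j)" for j
      by (intro L2_I_integrable_mult[OF f] continuous_intros zc)
    have 2: "integrable I_meas (\<lambda>y. f y * (\<Sum>j=m..K. of_nat (K choose j) * z y ^ j))"
      by (intro L2_I_integrable_mult[OF f] continuous_intros zc)
    show ?thesis
      by (subst Bochner_Integration.integral_add)
        (use 1 2 in \<open>simp_all add: Bochner_Integration.integral_sum\<close>)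
  qed
  also have "cmod \<dots> \<le> (\<Sum>j<m. real (K choose j) * 2 ^ j * \<eta>)
    + sqrt 2 * (\<Sum>j=m..K. \<bar>\<xi>\<bar> ^ j / fact j) * L2_norm I_meas f"
  proof (intro norm_triangle_mono sum_norm_le)
    fix j assume "j \<in> {..<m}"
    then show "cmod (of_nat (K choose j) * (\<integral>y. f y * z y ^ j \<partial>I_meas)) \<le> real (K choose j) * 2 ^ j * \<eta>"
      using moment[of j] by (simp add: norm_mult mult.assoc mult_left_mono)
  next
    show "cmod (\<integral>y. f y * (\<Sum>j=m..K. of_nat (K choose j) * z y ^ j) \<partial>I_meas)
      \<le> sqrt 2 * (\<Sum>j=m..K. \<bar>\<xi>\<bar> ^ j / fact j) * L2_norm I_meas f"
    proof (rule integral_kernel_bound[OF f])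
      show "(\<lambda>y. \<Sum>j=m..K. of_nat (K choose j) * z y ^ j) \<in> borel_measurable I_meas"
        by (intro continuous_on_lebesgue_on_measurable continuous_intros zc)
      fix y :: real assume y: "y \<in> {-1..1}"
      show "cmod (\<Sum>j=m..K. of_nat (K choose j) * z y ^ j) \<le> (\<Sum>j=m..K. \<bar>\<xi>\<bar> ^ j / fact j)"
      proof (rule sum_norm_le)
        fix j
        \<comment> \<open>The bound \<open>K ^ j / fact j\<close> on the binomial coefficient
          cancels the power of \<open>K\<close> in \<open>\<bar>h\<bar> ^ j\<close>, so the tail is
          independent of the choice of \<open>K\<close> except for its length.\<close>
        have "real (K choose j) * fact j \<le> real K ^ j"
          using binomial_fact_pow[of K j] by (metis of_nat_fact of_nat_le_iff of_nat_mult of_nat_power)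
        then have "real (K choose j) \<le> real K ^ j / fact j" by (simp add: divide_simps)
        moreover have "cmod (z y) ^ j \<le> \<bar>h\<bar> ^ j" by (intro power_mono z_le y) auto
        ultimately have "real (K choose j) * cmod (z y) ^ j \<le> (real K ^ j / fact j) * \<bar>h\<bar> ^ j"
          by (intro mult_mono) auto
        also have "\<dots> = \<bar>\<xi>\<bar> ^ j / fact j"
          using K by (simp add: h_def power_divide)
        finally show "cmod (of_nat (K choose j) * z y ^ j) \<le> \<bar>\<xi>\<bar> ^ j / fact j"
          by (simp add: norm_mult norm_power)
      qed
    qed (auto intro!: sum_nonneg)
  qed
  finally show ?thesis .
qed

lemma power_div_fact_le_exp:
  fixes x :: real
  assumes "x \<ge> 0"
  shows "x ^ n / fact n \<le> exp x"
proof -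
  have "x ^ n / fact n = (\<Sum>k\<in>{n}. x ^ k /\<^sub>R fact k)" by (simp add: divide_inverse mult.commute)
  also have "\<dots> \<le> (\<Sum>k. x ^ k /\<^sub>R fact k)"
    using assms by (intro sum_le_suminf summable_exp_generic) auto
  also have "\<dots> = exp x" by (simp add: exp_def)
  finally show ?thesis .
qed

lemma sum_power_le_power:
  fixes x :: real
  assumes "x \<ge> 2"
  shows "(\<Sum>j<m. x ^ j) \<le> x ^ m"
proof (induction m)
  case (Suc m)
  have "(\<Sum>j<Suc m. x ^ j) \<le> 2 * x ^ m" using Suc by simp
  also have "\<dots> \<le> x ^ Suc m" using assms by (simp add: mult_right_mono)
  finally show ?case .
qed simp

section \<open>Super-exponential smallness of the eigenvalues and on the band\<close>

context pswf_basis
begin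

text \<open>A min-max argument. A nonzero combination of \<open>\<psi> 0, ..., \<psi> n\<close> with
  vanishing moments of order below \<open>n\<close> has a transform consisting of Taylor remainders
  only, so its energy on the band is small. As the eigenvalues decrease, that energy is at least
  \<open>2 * pi * \<mu> n\<close> times the sum of squared coefficients.\<close>

lemma eigenvalue_bound: "\<mu> n \<le> c * (real n + 1) * (c ^ n / fact n)\<^sup>2"
proof -
  define m where "m i j = (\<integral>y. \<psi> i y * complex_of_real y ^ j \<partial>I_meas)" for i j
  obtain a where a: "\<exists>i\<le>n. a i \<noteq> 0" "\<forall>j<n. (\<Sum>i\<le>n. a i * m i j) = 0"
    using underdetermined_system[of n m] by blast
  define A where "A = (\<Sum>i\<le>n. (cmod (a i))\<^sup>2)"
  \<comment> \<open>The Taylor remainder of order \<open>n\<close> for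
    \<open>\<bar>y * t\<bar> \<le> c\<close>.\<close>
  define E where "E = c ^ n / fact n"
  have E0: "E \<ge> 0" using c by (simp add: E_def)
  obtain k where k: "k \<le> n" "a k \<noteq> 0" using a(1) by blast
  have "0 < (cmod (a k))\<^sup>2" using k by simp
  also have "\<dots> \<le> A" unfolding A_def by (rule member_le_sum) (use k in auto)
  finally have A: "A > 0" .
  define T where "T t y = (\<Sum>j<n. (\<i> * of_real (- (y * t))) ^ j / fact j)" for t y
  define r where "r i t = (\<integral>y. \<psi> i y * (cis (- (y * t)) - T t y) \<partial>I_meas)" for i t
  have Tc: "continuous_on UNIV (T t)" for t unfolding T_def by (intro continuous_intros) auto
  have r_le: "cmod (r i t) \<le> sqrt 2 * E" if "\<bar>t\<bar> \<le> c" for i t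
  proof -
    have "cmod (r i t) \<le> sqrt 2 * E * L2_norm I_meas (\<psi> i)"
      unfolding r_def
    proof (rule integral_kernel_bound[OF \<psi>_L2 _ _ E0])
      show "(\<lambda>y. cis (- (y * t)) - T t y) \<in> borel_measurable I_meas"
        by (intro continuous_on_lebesgue_on_measurable continuous_intros Tc)
      fix y :: real assume y: "y \<in> {-1..1}"
      have "\<bar>- (y * t)\<bar> \<le> 1 * c"
        using that y unfolding abs_minus_cancel abs_mult by (intro mult_mono) auto
      then have "\<bar>- (y * t)\<bar> ^ n / fact n \<le> E"
        unfolding E_def by (intro divide_right_mono power_mono) auto
      then show "cmod (cis (- (y * t)) - T t y) \<le> E"
        using norm_cis_Taylor[of "- (y * t)" n] unfolding T_def by linarith
    qed
    then show ?thesis by simp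
  qed
  have osc: "osc (\<psi> i) t = r i t + (\<Sum>j<n. (- \<i> * of_real t) ^ j / fact j * m i j)" for i t
  proof -
    have "r i t = osc (\<psi> i) t - (\<integral>y. \<psi> i y * T t y \<partial>I_meas)"
      unfolding r_def osc_def right_diff_distrib
      by (rule Bochner_Integration.integral_diff)
        (intro L2_I_integrable_mult[OF \<psi>_L2] continuous_intros Tc)+
    also have "(\<integral>y. \<psi> i y * T t y \<partial>I_meas)
        = (\<integral>y. (\<Sum>j<n. (- \<i> * of_real t) ^ j / fact j * (\<psi> i y * complex_of_real y ^ j)) \<partial>I_meas)"
      unfolding T_def sum_distrib_left
      by (intro Bochner_Integration.integral_cong sum.cong refl) (simp add: power_mult_distrib power_minus')
    also have "\<dots> = (\<Sum>j<n. (- \<i> * of_real t) ^ j / fact j * m i j)"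
    proof -
      have "integrable I_meas (\<lambda>y. \<psi> i y * complex_of_real y ^ j)" for j
        by (intro L2_I_integrable_mult[OF \<psi>_L2] continuous_intros)
      then show ?thesis
        unfolding m_def by (subst Bochner_Integration.integral_sum) auto
    qed
    finally show ?thesis by simp
  qed
  \<comment> \<open>The polynomial part of the combination is a sum of its moments, which vanish by
    the choice of \<open>a\<close>.\<close>
  have combo: "(\<Sum>i\<le>n. a i * osc (\<psi> i) t) = (\<Sum>i\<le>n. a i * r i t)" for t
  proof -
    have "(\<Sum>i\<le>n. a i * (\<Sum>j<n. (- \<i> * of_real t) ^ j / fact j * m i j))
        = (\<Sum>j<n. (- \<i> * of_real t) ^ j / fact j * (\<Sum>i\<le>n. a i * m i j))"
      unfolding sum_distrib_left by (subst sum.swap) (simp add: mult_ac)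
    also have "\<dots> = 0" using a(2) by simp
    finally show ?thesis unfolding osc distrib_left sum.distrib by simp
  qed
  have bd: "(cmod (\<Sum>i\<le>n. a i * osc (\<psi> i) t))\<^sup>2 \<le> A * ((real n + 1) * (2 * E\<^sup>2))" if t: "\<bar>t\<bar> \<le> c" for t
  proof -
    have "cmod (\<Sum>i\<le>n. a i * osc (\<psi> i) t) \<le> (\<Sum>i\<le>n. cmod (a i) * cmod (r i t))"
      unfolding combo by (rule sum_norm_le) (simp add: norm_mult)
    then have "(cmod (\<Sum>i\<le>n. a i * osc (\<psi> i) t))\<^sup>2 \<le> (\<Sum>i\<le>n. cmod (a i) * cmod (r i t))\<^sup>2"
      by (rule power_mono) simp
    also have "\<dots> \<le> A * (\<Sum>i\<le>n. (cmod (r i t))\<^sup>2)"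
      unfolding A_def by (rule Cauchy_Schwarz_ineq_sum)
    also have "(\<Sum>i\<le>n. (cmod (r i t))\<^sup>2) \<le> (\<Sum>i\<le>n. (sqrt 2 * E)\<^sup>2)"
      by (intro sum_mono power_mono r_le t) auto
    also have "\<dots> = (real n + 1) * (2 * E\<^sup>2)"
      by (simp add: power_mult_distrib)
    finally show ?thesis using A by (simp add: mult_left_mono)
  qed
  have "2 * pi * \<mu> n * A = (\<Sum>i\<le>n. (cmod (a i))\<^sup>2 * (2 * pi * \<mu> n))"
    unfolding A_def sum_distrib_left by (intro sum.cong refl mult.commute)
  also have "\<dots> \<le> (\<Sum>i\<le>n. (cmod (a i))\<^sup>2 * (2 * pi * \<mu> i))"
    by (intro sum_mono mult_left_mono \<mu>_decreasing) auto
  also have "\<dots> = (\<integral>t. (cmod (\<Sum>i\<le>n. a i * osc (\<psi> i) t))\<^sup>2 \<partial>lebesgue_on {-c..c})"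
    by (rule osc_combination_norm[symmetric])
  also have "\<dots> \<le> (\<integral>t. A * ((real n + 1) * (2 * E\<^sup>2)) \<partial>lebesgue_on {-c..c})"
  proof (rule Bochner_Integration.integral_mono)
    show "integrable (lebesgue_on {-c..c}) (\<lambda>t. (cmod (\<Sum>i\<le>n. a i * osc (\<psi> i) t))\<^sup>2)"
      by (intro integrable_continuous_Icc continuous_intros osc_continuous \<psi>_L2)
    show "integrable (lebesgue_on {-c..c}) (\<lambda>t. A * ((real n + 1) * (2 * E\<^sup>2)))"
      by (intro integrable_continuous_Icc continuous_intros)
  qed (use bd in auto)
  also have "\<dots> = 2 * c * (A * ((real n + 1) * (2 * E\<^sup>2)))"
    using c by (simp add: measure_restrict_space)
  finally have "pi * \<mu> n * A \<le> (2 * c * ((real n + 1) * E\<^sup>2)) * A"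
    by (simp add: mult_ac)
  then have "pi * \<mu> n \<le> 2 * c * ((real n + 1) * E\<^sup>2)"
    using A by simp
  \<comment> \<open>Bounding \<pi> below by 2 cancels the 2 from the length of the band.\<close>
  moreover have "2 * \<mu> n \<le> pi * \<mu> n"
    using pi_gt3 \<mu>_pos[of n] by (intro mult_right_mono) auto
  ultimately show ?thesis by (simp add: E_def mult_ac)
qed

text \<open>A Lipschitz function that is large at one point has large \<open>L\<^sup>2\<close> norm.\<close>

lemma osc_band_bound:
  assumes t0: "\<bar>t0\<bar> \<le> c"
  shows "cmod (osc (\<psi> n) t0) ^ 3 \<le> 80 * \<mu> n"
proof -
  define \<eta> where "\<eta> = cmod (osc (\<psi> n) t0)"
  \<comment> \<open>The Lipschitz constant is \<open>sqrt 2\<close>, so within distance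
    \<open>L\<close> of \<open>t0\<close> the modulus stays above \<open>\<eta> / 2\<close>.\<close>
  define L where "L = \<eta> / (2 * sqrt 2)"
  have \<eta>0: "\<eta> \<ge> 0" by (simp add: \<eta>_def)
  have "\<eta> \<le> sqrt 2" using osc_bound[OF \<psi>_L2, of n t0] by (simp add: \<eta>_def)
  then have L: "0 \<le> L" "L \<le> 1/2" using \<eta>0 by (simp_all add: L_def divide_simps)
  \<comment> \<open>The interval of length \<open>L\<close> extends from \<open>t0\<close> towards
    0; since \<open>L \<le> 1/2\<close> and \<open>c \<ge> 1\<close>, it remains inside the band
    even if \<open>t0\<close> is an endpoint.\<close>
  define p where "p = (if t0 \<le> 0 then t0 else t0 - L)"
  have sub: "{p..p+L} \<subseteq> {-c..c}" using t0 L c by (auto simp: p_def)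
  have big: "(\<eta> / 2)\<^sup>2 * indicator {p..p+L} t \<le> (cmod (osc (\<psi> n) t))\<^sup>2" for t
  proof (cases "t \<in> {p..p+L}")
    case True
    then have "\<bar>t - t0\<bar> \<le> L" using L by (auto simp: p_def split: if_splits)
    then have "sqrt 2 * \<bar>t0 - t\<bar> \<le> sqrt 2 * L" by (simp add: abs_minus_commute)
    also have "\<dots> = \<eta> / 2" by (simp add: L_def)
    finally have "cmod (osc (\<psi> n) t0 - osc (\<psi> n) t) \<le> \<eta> / 2"
      using osc_Lipschitz[OF \<psi>_L2, of n t0 t] by simp
    then have "\<eta> / 2 \<le> cmod (osc (\<psi> n) t)"
      using norm_triangle_ineq2[of "osc (\<psi> n) t0" "osc (\<psi> n) t"] by (simp add: \<eta>_def)
    then show ?thesis using True \<eta>0 by (simp add: power_mono)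
  qed simp
  have "(\<eta> / 2)\<^sup>2 * L = (\<integral>t. (\<eta> / 2)\<^sup>2 * indicator {p..p+L} t \<partial>lebesgue_on {-c..c})"
    using sub L by (simp add: measure_restrict_space Int_absorb2)
  also have "\<dots> \<le> (\<integral>t. (cmod (osc (\<psi> n) t))\<^sup>2 \<partial>lebesgue_on {-c..c})"
  proof (rule Bochner_Integration.integral_mono)
    show "integrable (lebesgue_on {-c..c}) (\<lambda>t. (cmod (osc (\<psi> n) t))\<^sup>2)"
      by (intro integrable_continuous_Icc continuous_intros osc_continuous \<psi>_L2)
    show "integrable (lebesgue_on {-c..c}) (\<lambda>t. (\<eta> / 2)\<^sup>2 * indicator {p..p+L} t)"
      using sub by (intro integrable_mult_right integrable_real_indicator)
        (auto simp: sets_restrict_space emeasure_restrict_space Int_absorb2 image_iff emeasure_lborel_Icc_eq intro!: bexI[of _ "{p..p+L}"])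
  qed (rule big)
  also have "\<dots> = 2 * pi * \<mu> n" by (rule osc_norm)
  finally have "\<eta> ^ 3 \<le> (16 * sqrt 2 * pi) * \<mu> n"
    by (simp add: L_def power2_eq_square power3_eq_cube field_simps)
  also have "(16 * sqrt 2 * pi) \<le> 80"
  proof -
    have "sqrt 2 \<le> 3/2" by (rule real_le_lsqrt) (auto simp: power2_eq_square)
    then have "sqrt 2 * pi \<le> (3/2) * 3.2"
      using pi_approx by (intro mult_mono) auto
    then show ?thesis unfolding mult.assoc by linarith
  qed
  then have "(16 * sqrt 2 * pi) * \<mu> n \<le> 80 * \<mu> n"
    using \<mu>_pos[of n] by (intro mult_right_mono) auto
  finally show ?thesis by (simp add: \<eta>_def)
qed

end

section \<open>Numerical estimates for the extrapolation\<close>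

text \<open>A weak form of Stirling's formula: one term of the exponential series at
  \<open>j\<close>.\<close>

lemma self_power_le_exp_fact: "real j ^ j \<le> exp (real j) * fact j"
  using power_div_fact_le_exp[of "real j" j] by (simp add: divide_simps)

text \<open>The first factor grows like \<open>n ^ (6 * m)\<close> with
  \<open>6 * m \<le> 3 * n / 2\<close>, while the last one decays like \<open>n ^ (- 2 * n)\<close>.
  The exponent \<open>3 * m\<close> is the cube of the extrapolation weight, because
  \<open>osc_band_bound\<close> controls a cube.\<close>

lemma extrapolation_weight_bound:
  fixes c :: real
  assumes c: "c \<ge> 1" and n: "n \<ge> 1" and m: "4 * m \<le> n"
  shows "(4 * real n ^ 2) ^ (3 * m) * (real n + 1) * (c ^ n / fact n)\<^sup>2 \<le> exp (16 * (c * exp 1) ^ 4)"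
    (is "?X \<le> exp (16 * ?b)")
proof -
  have X0: "?X \<ge> 0" using c by simp
  have b0: "?b \<ge> 0" using c by simp
  have fact: "real n ^ n \<le> exp 1 ^ n * fact n"
    using self_power_le_exp_fact[of n] by (simp add: exp_of_nat_mult[symmetric])
  \<comment> \<open>Squaring avoids half-integer exponents: \<open>12 * m \<le> 3 * n\<close> now
    bounds the power of \<open>2 * n\<close>, against a decay of order
    \<open>n ^ (- 4 * n)\<close>.\<close>
  have X2: "?X\<^sup>2 = ((4 * real n ^ 2) ^ (6 * m)) * (real n + 1)\<^sup>2 * (c ^ n / fact n) ^ 4"
    by (simp add: power_mult_distrib power_divide mult.commute flip: power_mult)
  have "(4 * real n ^ 2) ^ (6 * m) = (2 * real n) ^ (12 * m)"
  proof -
    have "4 * real n ^ 2 = (2 * real n) ^ 2" by (simp add: power_mult_distrib)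
    then show ?thesis by (simp only: power_mult[symmetric]) simp
  qed
  also have "\<dots> \<le> (2 * real n) ^ (3 * n)"
    using n m by (intro power_increasing) auto
  finally have b1: "(4 * real n ^ 2) ^ (6 * m) \<le> (2 * real n) ^ (3 * n)" .
  have b2: "(real n + 1)\<^sup>2 \<le> (2 ^ n)\<^sup>2"
  proof (rule power_mono)
    have "n + 1 \<le> 2 ^ n" by (induction n) auto
    from of_nat_mono[OF this, where 'a = real] show "real n + 1 \<le> 2 ^ n"
      by simp
  qed simp
  have b3: "(c ^ n / fact n) ^ 4 \<le> (c ^ n * exp 1 ^ n / real n ^ n) ^ 4"
  proof (rule power_mono)
    have "c ^ n * real n ^ n \<le> c ^ n * (exp 1 ^ n * fact n)"
      using fact c by (intro mult_left_mono) auto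
    then show "c ^ n / fact n \<le> c ^ n * exp 1 ^ n / real n ^ n"
      using n by (simp add: divide_simps mult_ac)
  qed (use c in simp)
  have "?X\<^sup>2 \<le> (2 * real n) ^ (3 * n) * (2 ^ n)\<^sup>2 * (c ^ n * exp 1 ^ n / real n ^ n) ^ 4"
    unfolding X2 by (intro mult_mono b1 b2 b3) (use c in auto)
  also have "(2 * real n) ^ (3 * n) * (2 ^ n)\<^sup>2 * (c ^ n * exp 1 ^ n / real n ^ n) ^ 4
      = (32 * ?b) ^ n / real n ^ n"
  proof -
    have 1: "(2 * real n) ^ (3 * n) = ((2 * real n) ^ 3) ^ n"
      by (simp only: power_mult)
    have 2: "((2::real) ^ n)\<^sup>2 = (2 ^ 2) ^ n"
      by (simp only: power_mult[symmetric] mult.commute)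
    have "c ^ n * exp 1 ^ n / real n ^ n = (c * exp 1 / real n) ^ n"
      by (simp only: power_mult_distrib power_divide)
    then have 3: "(c ^ n * exp 1 ^ n / real n ^ n) ^ 4 = ((c * exp 1 / real n) ^ 4) ^ n"
      by (simp only: power_mult[symmetric] mult.commute)
    have "(2 * real n) ^ (3 * n) * (2 ^ n)\<^sup>2 * (c ^ n * exp 1 ^ n / real n ^ n) ^ 4
      = ((2 * real n) ^ 3 * 2 ^ 2 * (c * exp 1 / real n) ^ 4) ^ n"
      unfolding 1 2 3 by (simp only: power_mult_distrib)
    also have "(2 * real n) ^ 3 * 2 ^ 2 * (c * exp 1 / real n) ^ 4 = 32 * ?b / real n"
      using n by (simp add: power_mult_distrib power_divide power3_eq_cube power4_eq_xxxx)
    finally show ?thesis by (simp add: power_divide)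
  qed
  \<comment> \<open>Replacing \<open>n ^ n\<close> by the factorial leaves a single term of the
    exponential series.\<close>
  also have "\<dots> \<le> (32 * ?b) ^ n / fact n"
    using n b0 fact_le_power[of n, where 'a = real] by (intro divide_left_mono) auto
  also have "\<dots> \<le> exp (32 * ?b)"
    using b0 by (intro power_div_fact_le_exp) simp
  also have "\<dots> = (exp (16 * ?b))\<^sup>2"
    by (simp add: power2_eq_square flip: exp_add)
  finally show ?thesis
    by (rule power2_le_imp_le) simp
qed

text \<open>For \<open>j \<ge> m\<close> the assumptions give \<open>x \<le> j / 8\<close>; with
  \<open>j ^ j \<le> exp j * fact j\<close> and \<open>exp 1 \<le> 4\<close> each term is at most
  \<open>(1/2) ^ j\<close>. This is where the threshold 64 comes from.\<close>

lemma exponential_tail_bound: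
  assumes x: "0 \<le> x" "64 * x \<le> real n" and m: "n \<le> 8 * m"
  shows "(\<Sum>j=m..K. x ^ j / fact j) \<le> 2 * (1/2) ^ m"
proof -
  have "x ^ j / fact j \<le> (1/2) ^ j" if "j \<ge> m" for j
  proof -
    have "n \<le> 8 * j" using m that by simp
    then have "real n \<le> 8 * real j" by (metis of_nat_le_iff of_nat_mult of_nat_numeral)
    then have "x ^ j \<le> (real j / 8) ^ j" using x by (intro power_mono) auto
    also have "\<dots> \<le> exp 1 ^ j * fact j / 8 ^ j"
      using self_power_le_exp_fact[of j]
      by (simp add: power_divide divide_right_mono exp_of_nat_mult[symmetric])
    also have "\<dots> \<le> 4 ^ j * fact j / 8 ^ j"
      using exp_le by (intro divide_right_mono mult_right_mono power_mono) auto
    also have "\<dots> = (1/2) ^ j * fact j"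
    proof -
      have "(8::real) ^ j = 4 ^ j * 2 ^ j" by (simp flip: power_mult_distrib)
      then show ?thesis by (simp add: power_divide)
    qed
    finally show ?thesis by (simp add: divide_simps)
  qed
  then have "(\<Sum>j=m..K. x ^ j / fact j) \<le> (\<Sum>j=m..K. (1/2) ^ j)"
    by (intro sum_mono) auto
  also have "\<dots> \<le> 2 * (1/2 :: real) ^ m"
    by (cases "m \<le> K") (simp_all add: sum_gp)
  finally show ?thesis .
qed

section \<open>Exponential decay at frequencies up to \<open>n / 64\<close>\<close>

context pswf_basis
begin

text \<open>The extrapolation is applied with \<open>m = n div 4\<close> and
  \<open>K = n * n\<close>. Its growth on the low powers is beaten by the super-exponential
  smallness of \<open>osc (\<psi> n)\<close> on the band; the high powers form an exponential
  tail.\<close>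

lemma osc_decay: "\<exists>C. \<forall>n \<xi>. \<bar>\<xi>\<bar> \<le> real n / 64 \<longrightarrow> cmod (osc (\<psi> n) \<xi>) \<le> C * (1/2) ^ (n div 4)"
proof -
  define D where "D = 80 * c * exp (16 * (c * exp 1) ^ 4)"
  \<comment> \<open>\<open>1 + D\<close> bounds the low powers and \<open>2 * sqrt 2\<close> the
    tail; the latter also covers \<open>n < 4\<close>, where the exponent \<open>n div 4\<close> is
    0.\<close>
  define C where "C = 1 + D + 2 * sqrt 2"
  have D0: "D \<ge> 0" using c by (simp add: D_def)
  show ?thesis
  proof (intro exI[of _ C] allI impI)
    fix n \<xi>
    assume \<xi>: "\<bar>\<xi>\<bar> \<le> real n / 64"
    define m where "m = n div 4"
    show "cmod (osc (\<psi> n) \<xi>) \<le> C * (1/2) ^ (n div 4)"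
    proof (cases "n \<ge> 4")
      case False
      then have "m = 0" by (simp add: m_def)
      then show ?thesis
        using osc_bound[OF \<psi>_L2, of n \<xi>] D0 unfolding m_def[symmetric] C_def
        by simp (smt (verit) real_sqrt_ge_0_iff)
    next
      case True
      have m: "4 * m \<le> n" "n \<le> 8 * m" using True unfolding m_def by presburger+
      define K where "K = n * n"
      define \<eta> where "\<eta> = root 3 (80 * \<mu> n)"
      have \<eta>3: "\<eta> ^ 3 = 80 * \<mu> n" using \<mu>_pos[of n] by (simp add: \<eta>_def)
      have \<eta>0: "\<eta> \<ge> 0" using \<mu>_pos[of n] by (simp add: \<eta>_def)
      have \<eta>: "cmod (osc (\<psi> n) t) \<le> \<eta>" if "\<bar>t\<bar> \<le> c" for t
        using osc_band_bound[OF that, of n] \<eta>0 unfolding \<eta>3[symmetric]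
        by (simp add: power_mono_iff)
      \<comment> \<open>With \<open>K = n * n\<close> the sampled frequencies remain in the band,
        because \<open>m\<close> and \<open>\<bar>\<xi>\<bar>\<close> are at most \<open>n\<close>
        and \<open>c \<ge> 1\<close>.\<close>
      have mn: "real m * \<bar>\<xi>\<bar> \<le> real n * real n"
        using \<xi> m by (intro mult_mono) auto
      also have "\<dots> \<le> real K * c" using c by (simp add: K_def mult_left_mono[of 1 c, simplified])
      finally have mK: "real m * \<bar>\<xi>\<bar> \<le> real K * c" .
      have "m \<le> K" using m True by (auto simp: K_def intro: order_trans[of m n])
      note main = osc_extrapolation[OF \<psi>_L2[of n] \<eta> _ this mK]
      have 1: "(\<Sum>j<m. real (K choose j) * 2 ^ j * \<eta>) \<le> (1 + D) * (1/2) ^ m"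
      proof -
        define W where "W = (2 * real n ^ 2) ^ m"
        have "real (K choose j) * 2 ^ j \<le> (2 * real n ^ 2) ^ j" for j
        proof -
          have "K choose j \<le> K ^ j"
            by (cases "j \<le> K") (simp_all add: binomial_le_pow binomial_eq_0)
          then have "real (K choose j) \<le> (real n ^ 2) ^ j"
            by (metis K_def of_nat_le_iff of_nat_mult of_nat_power power2_eq_square)
          then show ?thesis by (simp add: power_mult_distrib mult.commute)
        qed
        then have "(\<Sum>j<m. real (K choose j) * 2 ^ j * \<eta>) \<le> (\<Sum>j<m. (2 * real n ^ 2) ^ j * \<eta>)"
          using \<eta>0 by (intro sum_mono mult_right_mono) auto
        also have "\<dots> \<le> W * \<eta>"
        proof -
          have "1 \<le> real n ^ 2" using True by simp
          then show ?thesis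
            unfolding W_def sum_distrib_right[symmetric]
            using \<eta>0 by (intro mult_right_mono sum_power_le_power) auto
        qed
        also have "\<dots> \<le> (1 + D) * (1/2) ^ m"
        proof -
          \<comment> \<open>\<open>Y\<close> is the low-power bound rescaled by
            \<open>2 ^ m\<close>. Its cube contains \<open>\<eta> ^ 3 = 80 * \<mu> n\<close>, to
            which the eigenvalue bound applies.\<close>
          define Y where "Y = 2 ^ m * (W * \<eta>)"
          have Y0: "Y \<ge> 0" using \<eta>0 by (simp add: Y_def W_def)
          have "4 * real n ^ 2 = 2 * (2 * real n ^ 2)" by simp
          then have "2 ^ m * W = (4 * real n ^ 2) ^ m"
            by (simp only: W_def power_mult_distrib)
          then have W3: "(2 ^ m * W) ^ 3 = (4 * real n ^ 2) ^ (3 * m)"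
            by (simp only: power_mult[symmetric] mult.commute)
          have "Y ^ 3 = (2 ^ m * W) ^ 3 * \<eta> ^ 3"
            unfolding Y_def by (simp add: power_mult_distrib mult_ac)
          also have "\<dots> = (4 * real n ^ 2) ^ (3 * m) * (80 * \<mu> n)"
            by (simp only: W3 \<eta>3)
          also have "\<dots> \<le> (4 * real n ^ 2) ^ (3 * m) * (80 * (c * (real n + 1) * (c ^ n / fact n)\<^sup>2))"
            by (intro mult_left_mono eigenvalue_bound) auto
          also have "\<dots> = 80 * c * ((4 * real n ^ 2) ^ (3 * m) * (real n + 1) * (c ^ n / fact n)\<^sup>2)"
            by simp
          also have "\<dots> \<le> D"
            unfolding D_def using c True m by (intro mult_left_mono extrapolation_weight_bound) auto
          finally have Y3: "Y ^ 3 \<le> D" .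
          \<comment> \<open>The cube root is avoided: either \<open>Y \<le> 1\<close> or
            \<open>Y \<le> Y ^ 3\<close>.\<close>
          have "Y \<le> 1 + D"
          proof (cases "Y \<le> 1")
            case False
            then have "Y ^ 1 \<le> Y ^ 3" by (intro power_increasing) auto
            then show ?thesis using Y3 by simp
          qed (use D0 in simp)
          then show ?thesis by (simp add: Y_def field_simps power_divide)
        qed
        finally show ?thesis .
      qed
      have "sqrt 2 * (\<Sum>j=m..K. \<bar>\<xi>\<bar> ^ j / fact j) \<le> sqrt 2 * (2 * (1/2) ^ m)"
        using \<xi> m by (intro mult_left_mono exponential_tail_bound[of _ n]) auto
      moreover have "cmod (osc (\<psi> n) \<xi>) \<le> (\<Sum>j<m. real (K choose j) * 2 ^ j * \<eta>)
          + sqrt 2 * (\<Sum>j=m..K. \<bar>\<xi>\<bar> ^ j / fact j)"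
        using main True by (simp add: K_def)
      ultimately have "cmod (osc (\<psi> n) \<xi>) \<le> (1 + D) * (1/2) ^ m + sqrt 2 * (2 * (1/2) ^ m)"
        using 1 by linarith
      then show ?thesis by (simp add: C_def m_def algebra_simps)
    qed
  qed
qed

end

section \<open>The approximation error\<close>

lemma integral_I_meas:
  fixes f :: "real \<Rightarrow> complex"
  shows "(\<integral>x. f x \<partial>I_meas) = (\<integral>x. indicator {-1..1} x *\<^sub>R f x \<partial>lebesgue)"
  by (rule integral_restrict_space) simp

section \<open>Eigenfunctions and expansion coefficients on the Fourier side\<close>

context pswf_basis
begin

text \<open>A representative of \<open>\<psi> n\<close>, extended by zero, that is Borel, bounded and continuous off \<open>{-1, 1}\<close>.\<close>

definition \<phi> :: "nat \<Rightarrow> real \<Rightarrow> complex" where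
  "\<phi> n x = indicator {-1..1} x *\<^sub>R (complex_of_real (1 / \<mu> n) * sinc_op c (\<psi> n) x)"

lemma c_pos: "c > 0"
  using c by simp

lemma eigenfunction_representative:
  "AE x in I_meas. \<psi> n x = complex_of_real (1 / \<mu> n) * sinc_op c (\<psi> n) x"
  using eigenfunction[of n]
proof eventually_elim
  case (elim x)
  then show ?case using \<mu>_pos[of n] by (simp add: field_simps)
qed

lemma representative_continuous:
  "continuous_on UNIV (\<lambda>x. complex_of_real (1 / \<mu> n) * sinc_op c (\<psi> n) x)"
  by (intro continuous_intros sinc_op_continuous[OF \<psi>_L2 c_pos])

lemma \<phi>_borel: "\<phi> n \<in> borel_measurable borel"
  unfolding \<phi>_def [abs_def]
  by (intro borel_measurable_scaleR borel_measurable_indicator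
      borel_measurable_continuous_onI[OF representative_continuous]) simp

lemma \<phi>_bounded: "\<exists>B. \<forall>x. cmod (\<phi> n x) \<le> B"
proof -
  obtain B where B: "\<And>x. cmod (sinc_op c (\<psi> n) x) \<le> B"
    using sinc_op_bounded[OF \<psi>_L2 c_pos] by blast
  have "cmod (\<phi> n x) \<le> 1 / \<mu> n * B" for x
  proof -
    have "cmod (\<phi> n x) \<le> 1 * (1 / \<mu> n * cmod (sinc_op c (\<psi> n) x))"
      unfolding \<phi>_def norm_scaleR norm_mult norm_of_real using \<mu>_pos[of n]
      by (intro mult_mono) (auto simp: indicator_def)
    also have "\<dots> \<le> 1 / \<mu> n * B"
      using B \<mu>_pos[of n] by (simp add: divide_right_mono)
    finally show ?thesis .
  qed
  then show ?thesis by blast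
qed

lemma \<phi>_integrable: "integrable lborel (\<phi> n)"
proof -
  obtain B where B: "\<And>x. cmod (\<phi> n x) \<le> B" using \<phi>_bounded by blast
  show ?thesis
  proof (rule integrableI_bounded_set[where A = "{-1..1}" and B = B])
    show "\<phi> n \<in> borel_measurable lborel" using \<phi>_borel by simp
    show "AE x in lborel. x \<in> {-1..1} \<longrightarrow> norm (\<phi> n x) \<le> B" using B by simp
    show "AE x in lborel. x \<notin> {-1..1} \<longrightarrow> \<phi> n x = 0" by (simp add: \<phi>_def)
  qed auto
qed

lemma \<phi>_continuous: "AE x in lebesgue. isCont (\<phi> n) x"
proof -
  have "isCont (\<phi> n) x" if x: "x \<noteq> -1" "x \<noteq> 1" for x
  proof (cases "x \<in> {-1<..<1}")
    case True
    have "\<forall>\<^sub>F y in nhds x. y \<in> {-1<..<1}"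
      using True by (intro eventually_nhds_in_open) auto
    then have ev: "\<forall>\<^sub>F y in nhds x. \<phi> n y = complex_of_real (1 / \<mu> n) * sinc_op c (\<psi> n) y"
      by eventually_elim (auto simp: \<phi>_def)
    have "isCont (\<lambda>x. complex_of_real (1 / \<mu> n) * sinc_op c (\<psi> n) x) x"
      using representative_continuous[of n] by (simp only: continuous_on_eq_continuous_at[OF open_UNIV]) blast
    then show ?thesis using isCont_cong[OF ev] by blast
  next
    case False
    have "\<forall>\<^sub>F y in nhds x. y \<in> - {-1..1}"
      using False x by (intro eventually_nhds_in_open) auto
    then have ev: "\<forall>\<^sub>F y in nhds x. \<phi> n y = 0"
      by eventually_elim (auto simp: \<phi>_def)
    show ?thesis using isCont_cong[OF ev] by simp
  qed
  moreover have "AE x in lebesgue. x \<noteq> -1 \<and> x \<noteq> (1::real)"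
    by (intro AE_conjI AE_completion AE_lborel_singleton)
  ultimately show ?thesis by (auto elim: eventually_mono)
qed

lemma fourier_\<phi>: "fourier (\<phi> n) \<xi> = complex_of_real (1 / sqrt (2 * pi)) * osc (\<psi> n) \<xi>"
proof -
  have cis: "(\<lambda>x. cis (- (x * \<xi>))) \<in> borel_measurable I_meas"
    by (intro continuous_on_lebesgue_on_measurable continuous_intros)
  have "osc (\<psi> n) \<xi> = (\<integral>x. complex_of_real (1 / \<mu> n) * sinc_op c (\<psi> n) x * cis (- (x * \<xi>)) \<partial>I_meas)"
    unfolding osc_def
  proof (rule integral_cong_AE)
    show "AE x in I_meas. \<psi> n x * cis (- (x * \<xi>))
        = complex_of_real (1 / \<mu> n) * sinc_op c (\<psi> n) x * cis (- (x * \<xi>))"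
      using eigenfunction_representative[of n] by eventually_elim simp
  qed (intro borel_measurable_times cis L2_measurable[OF \<psi>_L2]
      continuous_on_lebesgue_on_measurable[OF representative_continuous])+
  also have "\<dots> = (\<integral>x. \<phi> n x * cis (- (x * \<xi>)) \<partial>lebesgue)"
    unfolding integral_I_meas by (simp add: \<phi>_def)
  finally show ?thesis by (simp add: fourier_def)
qed

text \<open>As \<open>\<phi> n\<close> vanishes off the interval, only the values of
  \<open>F\<close> there matter. Applied to extensions \<open>F\<close> of \<open>f\<close> and to
  \<open>F = \<phi> m\<close>.\<close>

lemma inner_\<phi>:
  assumes "F \<in> borel_measurable lebesgue" and "f \<in> borel_measurable I_meas"
    and "AE x in I_meas. F x = f x"
  shows "L2_inner lebesgue F (\<phi> n) = L2_inner I_meas f (\<psi> n)"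
proof -
  have "L2_inner lebesgue F (\<phi> n)
      = L2_inner I_meas F (\<lambda>x. complex_of_real (1 / \<mu> n) * sinc_op c (\<psi> n) x)"
    unfolding L2_inner_def integral_I_meas
    by (intro Bochner_Integration.integral_cong refl) (simp add: \<phi>_def)
  also have "\<dots> = L2_inner I_meas f (\<psi> n)"
  proof (rule L2_inner_cong_AE)
    show "F \<in> borel_measurable I_meas" using assms(1) by (rule measurable_restrict_space1)
    show "AE x in I_meas. complex_of_real (1 / \<mu> n) * sinc_op c (\<psi> n) x = \<psi> n x"
      using eigenfunction_representative[of n] by eventually_elim simp
  qed (use assms L2_measurable[OF \<psi>_L2] continuous_on_lebesgue_on_measurable[OF representative_continuous] in auto)
  finally show ?thesis .
qed

lemma fourier_\<phi>_L2: "fourier (\<phi> n) \<in> L2 lebesgue"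
  using \<phi>_bounded by (blast intro: fourier_in_L2[OF \<phi>_integrable _ \<phi>_continuous])

text \<open>Plancherel transports the orthonormality of the \<psi> n to the whole line, which makes
  Bessel's inequality available for a function of frequency.\<close>

lemma fourier_\<phi>_orthonormal: "L2_orthonormal lebesgue (\<lambda>n. fourier (\<phi> n))"
  unfolding L2_orthonormal_def
proof (intro conjI allI)
  fix m n
  obtain B where B: "\<And>x. cmod (\<phi> n x) \<le> B" using \<phi>_bounded by blast
  have i: "integrable lebesgue (\<phi> m)"
    using \<phi>_integrable[of m] \<phi>_borel[of m] by (simp add: integrable_completion)
  have "L2_inner lebesgue (fourier (\<phi> m)) (fourier (\<phi> n)) = L2_inner lebesgue (\<phi> m) (\<phi> n)"
    by (rule Plancherel_inner[OF i fourier_\<phi>_L2 \<phi>_integrable B \<phi>_continuous])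
  also have "\<dots> = L2_inner I_meas (\<psi> m) (\<psi> n)"
  proof (rule inner_\<phi>)
    show "AE x in I_meas. \<phi> m x = \<psi> m x"
      using eigenfunction_representative[of m] AE_space
      by eventually_elim (auto simp: \<phi>_def)
  qed (use borel_measurable_lebesgue[OF \<phi>_borel] L2_measurable[OF \<psi>_L2] in auto)
  finally show "L2_inner lebesgue (fourier (\<phi> m)) (fourier (\<phi> n)) = (if m = n then 1 else 0)"
    using orthonormal by (simp add: L2_orthonormal_def)
qed (rule fourier_\<phi>_L2)

lemma coefficient_fourier:
  assumes FG: "has_fourier_L2 F G" and f: "f \<in> L2 I_meas" and eq: "AE x in I_meas. F x = f x"
  shows "L2_inner I_meas f (\<psi> n) = L2_inner lebesgue G (fourier (\<phi> n))"
proof -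
  obtain B where B: "\<And>x. cmod (\<phi> n x) \<le> B" using \<phi>_bounded by blast
  have "F \<in> borel_measurable lebesgue"
    using FG by (auto simp: has_fourier_L2_def L2_def)
  then have "L2_inner I_meas f (\<psi> n) = L2_inner lebesgue F (\<phi> n)"
    using inner_\<phi>[OF _ L2_measurable[OF f] eq] by simp
  also have "\<dots> = L2_inner lebesgue G (fourier (\<phi> n))"
    by (rule has_fourier_L2_inner[OF FG \<phi>_integrable _ B \<phi>_continuous]) (simp add: \<phi>_def)
  finally show ?thesis .
qed

text \<open>Completeness of the basis enters through the convergence of \<open>e\<close> to 0: the
  squared error at \<open>N\<close> is the squared error at \<open>K\<close> plus a finite block of
  squared coefficients, and \<open>K\<close> tends to infinity.\<close>

lemma partial_expansion_error:
  assumes f: "f \<in> L2 I_meas"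
    and Q: "\<And>K. K \<ge> N \<Longrightarrow> (\<Sum>n=N..<K. (cmod (L2_inner I_meas f (\<psi> n)))\<^sup>2) \<le> Q"
  shows "(L2_norm I_meas (\<lambda>x. f x - partial_expansion \<psi> N f x))\<^sup>2 \<le> Q"
proof -
  define a where "a n = (cmod (L2_inner I_meas f (\<psi> n)))\<^sup>2" for n
  define e where "e K = L2_norm I_meas (\<lambda>x. f x - partial_expansion \<psi> K f x)" for K
  have e: "(e K)\<^sup>2 = (L2_norm I_meas f)\<^sup>2 - (\<Sum>n<K. a n)" for K
    unfolding e_def a_def partial_expansion_def
    by (rule L2_norm_diff_projection[OF orthonormal f]) simp
  have le: "(e N)\<^sup>2 \<le> (e K)\<^sup>2 + Q" if K: "K \<ge> N" for K
  proof -
    have "(\<Sum>n<K. a n) = (\<Sum>n<N. a n) + (\<Sum>n=N..<K. a n)"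
      using K by (simp add: atLeast0LessThan[symmetric] sum.atLeastLessThan_concat)
    then show ?thesis using e[of N] e[of K] Q[OF K] by (simp add: a_def)
  qed
  have "e \<longlonglongrightarrow> 0"
    using pswf f by (simp add: e_def [abs_def] pswf_def orthonormal_basis_I_def)
  then have "(\<lambda>K. (e K)\<^sup>2 + Q) \<longlonglongrightarrow> 0\<^sup>2 + Q"
    by (intro tendsto_intros)
  then have "(e N)\<^sup>2 \<le> 0\<^sup>2 + Q"
    by (rule LIMSEQ_le_const) (use le in blast)
  then show ?thesis by (simp add: e_def)
qed

end

section \<open>Geometric sums and Sobolev weights\<close>

text \<open>Since \<open>1/4 \<le> (3/4) ^ 4\<close>, only the remainder of \<open>n\<close> modulo
  4 has to be paid for, and \<open>4 * (3/4) ^ 3 \<ge> 1\<close>.\<close>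

lemma geometric_div4: "(1/4::real) ^ (n div 4) \<le> 4 * (3/4) ^ n"
proof -
  define q r where "q = n div 4" and "r = n mod 4"
  have n: "n = 4 * q + r" by (simp add: q_def r_def)
  have r: "r \<le> 3" by (simp add: r_def)
  have "(1/4::real) ^ q \<le> ((3/4) ^ 4) ^ q"
    by (intro power_mono) (simp_all add: power_divide)
  also have "\<dots> = (3/4) ^ (4 * q)" by (simp only: power_mult)
  finally have "(1/4::real) ^ q * 1 \<le> (3/4) ^ (4 * q) * (4 * (3/4) ^ r)"
  proof (rule mult_mono)
    have "(3/4::real) ^ 3 \<le> (3/4) ^ r" using r by (intro power_decreasing) auto
    moreover have "(3/4::real) ^ 3 = 27/64" by (simp add: power3_eq_cube)
    ultimately show "1 \<le> 4 * (3/4::real) ^ r" by linarith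
  qed auto
  moreover have "(3/4::real) ^ n = (3/4) ^ (4 * q) * (3/4) ^ r"
    by (simp only: n power_add)
  ultimately show ?thesis by (simp add: q_def)
qed

lemma geometric_div4_sum: "(\<Sum>n=N..<K. (1/4::real) ^ (n div 4)) \<le> 16 * (3/4) ^ N"
proof (cases "N \<le> K")
  case True
  have "(\<Sum>n=N..<K. (1/4::real) ^ (n div 4)) \<le> (\<Sum>n=N..<K. 4 * (3/4) ^ n)"
    by (intro sum_mono geometric_div4)
  also have "\<dots> = 16 * ((3/4) ^ N - (3/4) ^ K)"
    using True by (induction K rule: dec_induct) auto
  also have "\<dots> \<le> 16 * (3/4) ^ N" by simp
  finally show ?thesis .
qed simp

text \<open>Exponential decay beats every power of \<open>N\<close>; this absorbs the low-frequency
  contribution, including a factor \<open>N\<close> from the length of the frequency window, into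
  the Sobolev rate.\<close>

lemma polynomial_times_geometric_bounded:
  assumes "s > 0"
  shows "\<exists>B\<ge>0. \<forall>N. real N * (3/4) ^ N \<le> B * (1 + (real N)\<^sup>2) powr (-s)"
proof -
  have "(\<lambda>N. real N * (3/4) ^ N * (1 + (real N)\<^sup>2) powr s) \<longlonglongrightarrow> 0"
    using assms by real_asymp
  then have "Bseq (\<lambda>N. real N * (3/4) ^ N * (1 + (real N)\<^sup>2) powr s)"
    by (intro convergent_imp_Bseq convergentI)
  then obtain B where B: "\<And>N. norm (real N * (3/4) ^ N * (1 + (real N)\<^sup>2) powr s) \<le> B"
    unfolding Bseq_def by blast
  have "real N * (3/4) ^ N \<le> B * (1 + (real N)\<^sup>2) powr (-s)" for N
  proof -
    have p: "1 + (real N)\<^sup>2 > 0" by (rule add_pos_nonneg) auto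
    have "real N * (3/4) ^ N * (1 + (real N)\<^sup>2) powr s \<le> B" using B[of N] by simp
    then show ?thesis using p by (simp add: powr_minus divide_simps)
  qed
  moreover have "B \<ge> 0" using B[of 0] by simp
  ultimately show ?thesis by blast
qed

text \<open>The weight is at least 1 everywhere and at least \<open>(1 + r\<^sup>2) powr s\<close>
  where \<open>\<bar>\<xi>\<bar> > r\<close>.\<close>

lemma sobolev_weighted_bounds:
  assumes G: "G \<in> L2 lebesgue" and W: "integrable lebesgue (sobolev_weighted s G)" and s: "s \<ge> 0"
    and r: "r \<ge> 0"
  shows "(L2_norm lebesgue G)\<^sup>2 \<le> (\<integral>\<xi>. sobolev_weighted s G \<xi> \<partial>lebesgue)"
    and "(L2_norm lebesgue (\<lambda>\<xi>. indicator {\<xi>. \<bar>\<xi>\<bar> > r} \<xi> * G \<xi>))\<^sup>2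
      \<le> (1 + r\<^sup>2) powr (-s) * (\<integral>\<xi>. sobolev_weighted s G \<xi> \<partial>lebesgue)"
proof -
  have w1: "1 \<le> (1 + \<xi>\<^sup>2) powr s" for \<xi> :: real
    using s by (intro ge_one_powr_ge_zero) auto
  show "(L2_norm lebesgue G)\<^sup>2 \<le> (\<integral>\<xi>. sobolev_weighted s G \<xi> \<partial>lebesgue)"
    unfolding L2_norm_power2
  proof (rule Bochner_Integration.integral_mono[OF L2_integrable[OF G] W])
    fix \<xi>
    show "(cmod (G \<xi>))\<^sup>2 \<le> sobolev_weighted s G \<xi>"
      using mult_right_mono[OF w1[of \<xi>], of "(cmod (G \<xi>))\<^sup>2"] by (simp add: sobolev_weighted_def)
  qed
  let ?H = "{\<xi>. \<bar>\<xi>\<bar> > r} :: real set"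
  have "?H = UNIV - {-r..r}" by auto
  then have H: "?H \<in> sets lebesgue" by simp
  have p: "1 + r\<^sup>2 > 0" by (rule add_pos_nonneg) auto
  have "(\<integral>\<xi>. (cmod (indicator ?H \<xi> * G \<xi>))\<^sup>2 \<partial>lebesgue)
      \<le> (\<integral>\<xi>. (1 + r\<^sup>2) powr (-s) * sobolev_weighted s G \<xi> \<partial>lebesgue)"
  proof (rule Bochner_Integration.integral_mono)
    show "integrable lebesgue (\<lambda>\<xi>. (cmod (indicator ?H \<xi> * G \<xi>))\<^sup>2)"
      by (rule L2_integrable[OF L2_cutoff[OF G H]])
    show "integrable lebesgue (\<lambda>\<xi>. (1 + r\<^sup>2) powr (-s) * sobolev_weighted s G \<xi>)"
      using W by (rule integrable_mult_right)
    fix \<xi> :: real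
    show "(cmod (indicator ?H \<xi> * G \<xi>))\<^sup>2 \<le> (1 + r\<^sup>2) powr (-s) * sobolev_weighted s G \<xi>"
    proof (cases "\<xi> \<in> ?H")
      case True
      then have "r\<^sup>2 \<le> \<xi>\<^sup>2" using r by (simp add: abs_le_square_iff[symmetric])
      then have "(1 + r\<^sup>2) powr s \<le> (1 + \<xi>\<^sup>2) powr s" using p s by (intro powr_mono2) auto
      then have "1 \<le> (1 + r\<^sup>2) powr (-s) * (1 + \<xi>\<^sup>2) powr s"
        using p by (simp add: powr_minus divide_simps)
      from mult_right_mono[OF this, of "(cmod (G \<xi>))\<^sup>2"] True show ?thesis
        by (simp add: sobolev_weighted_def mult.assoc)
    qed (simp add: sobolev_weighted_def)
  qed
  then show "(L2_norm lebesgue (\<lambda>\<xi>. indicator ?H \<xi> * G \<xi>))\<^sup>2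
      \<le> (1 + r\<^sup>2) powr (-s) * (\<integral>\<xi>. sobolev_weighted s G \<xi> \<partial>lebesgue)"
    unfolding L2_norm_power2 by simp
qed

section \<open>Splitting the frequencies at \<open>N / 64\<close>\<close>

context pswf_basis
begin

text \<open>The cutoff is moved onto the transform of \<psi> n; Cauchy-Schwarz then leaves the
  integral of the pointwise bound \<open>C\<^sup>2\<close> over an interval of length
  \<open>2 * r\<close>.\<close>

lemma low_frequency_coefficient:
  assumes G: "G \<in> L2 lebesgue" and r: "r \<ge> 0"
    and C: "\<And>\<xi>. \<bar>\<xi>\<bar> \<le> r \<Longrightarrow> cmod (osc (\<psi> n) \<xi>) \<le> C"
  shows "(cmod (L2_inner lebesgue (\<lambda>\<xi>. indicator {-r..r} \<xi> * G \<xi>) (fourier (\<phi> n))))\<^sup>2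
    \<le> (L2_norm lebesgue G)\<^sup>2 * (2 * r * C\<^sup>2)"
proof -
  let ?e = "\<lambda>\<xi>. indicator {-r..r} \<xi> * fourier (\<phi> n) \<xi>"
  have eL: "?e \<in> L2 lebesgue" by (rule L2_cutoff[OF fourier_\<phi>_L2]) simp
  have C0: "C \<ge> 0" using C[of 0] r norm_ge_zero[of "osc (\<psi> n) 0"] by linarith
  have "L2_inner lebesgue (\<lambda>\<xi>. indicator {-r..r} \<xi> * G \<xi>) (fourier (\<phi> n)) = L2_inner lebesgue G ?e"
    unfolding L2_inner_def by (intro Bochner_Integration.integral_cong refl) (simp add: indicator_def)
  then have "(cmod (L2_inner lebesgue (\<lambda>\<xi>. indicator {-r..r} \<xi> * G \<xi>) (fourier (\<phi> n))))\<^sup>2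
      \<le> (L2_norm lebesgue G)\<^sup>2 * (L2_norm lebesgue ?e)\<^sup>2"
    using L2_Cauchy_Schwarz[OF G eL] by (simp add: power_mono flip: power_mult_distrib)
  also have "(L2_norm lebesgue ?e)\<^sup>2 \<le> (\<integral>\<xi>. C\<^sup>2 * indicator {-r..r} \<xi> \<partial>lebesgue)"
    unfolding L2_norm_power2
  proof (rule Bochner_Integration.integral_mono[OF L2_integrable[OF eL]])
    show "integrable lebesgue (\<lambda>\<xi>. C\<^sup>2 * indicator {-r..r} \<xi> :: real)"
      by (intro integrable_mult_right integrable_real_indicator) (auto simp: emeasure_lborel_Icc_eq)
    fix \<xi> :: real
    show "(cmod (?e \<xi>))\<^sup>2 \<le> C\<^sup>2 * indicator {-r..r} \<xi>"
    proof (cases "\<xi> \<in> {-r..r}")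
      case True
      have "1 / sqrt (2 * pi) \<le> 1" using pi_gt3 by (simp add: divide_simps)
      then have "\<bar>1 / sqrt (2 * pi)\<bar> * cmod (osc (\<psi> n) \<xi>) \<le> 1 * C"
        using True C[of \<xi>] C0 by (intro mult_mono) (auto simp: abs_le_iff)
      then have "cmod (fourier (\<phi> n) \<xi>) \<le> C"
        unfolding fourier_\<phi> norm_mult norm_of_real by simp
      then show ?thesis using True by (simp add: power_mono)
    qed simp
  qed
  also have "\<dots> = 2 * r * C\<^sup>2" using r by simp
  finally show ?thesis by (simp add: mult_left_mono)
qed

text \<open>For each extension, the coefficients are split into low frequencies, summed as a
  geometric series, and high frequencies, summed by Bessel. The constant precedes all quantifiers so
  that an infimum over extensions can be taken afterwards.\<close>

lemma expansion_error_extension: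
  assumes s: "s > 0"
  shows "\<exists>Ms>0. \<forall>f F G N. f \<in> L2 I_meas \<longrightarrow> (F, G) \<in> sobolev_ext s f \<longrightarrow> N \<ge> 1 \<longrightarrow>
    L2_norm I_meas (\<lambda>x. f x - partial_expansion \<psi> N f x)
      \<le> Ms * (1 + (real N)\<^sup>2) powr (- s / 2) * sqrt (\<integral>\<xi>. sobolev_weighted s G \<xi> \<partial>lebesgue)"
proof -
  obtain C where C: "\<And>n \<xi>. \<bar>\<xi>\<bar> \<le> real n / 64 \<Longrightarrow> cmod (osc (\<psi> n) \<xi>) \<le> C * (1/2) ^ (n div 4)"
    using osc_decay by blast
  obtain B where B: "B \<ge> 0" "\<And>N. real N * (3/4) ^ N \<le> B * (1 + (real N)\<^sup>2) powr (-s)"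
    using polynomial_times_geometric_bounded[OF s] by blast
  \<comment> \<open>The first summand collects the low frequencies. In the second, 4096 is
    \<open>64\<^sup>2\<close>, from comparing \<open>1 + r\<^sup>2\<close> with
    \<open>1 + N\<^sup>2\<close>, and 2 comes from squaring a sum of two terms.\<close>
  define Q where "Q = C\<^sup>2 * B + 2 * 4096 powr s"
  have Q0: "Q > 0" using B by (auto simp: Q_def intro!: add_nonneg_pos)
  show ?thesis
  proof (intro exI[of _ "sqrt Q"] conjI allI impI)
    fix f F G and N :: nat
    assume f: "f \<in> L2 I_meas" and FG: "(F, G) \<in> sobolev_ext s f" and N: "N \<ge> 1"
    have ft: "has_fourier_L2 F G" and W: "integrable lebesgue (sobolev_weighted s G)"
      and eq: "AE x in I_meas. F x = f x"
      using FG by (auto simp: sobolev_ext_def)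
    have G: "G \<in> L2 lebesgue" using ft by (simp add: has_fourier_L2_def)
    define X where "X = (\<integral>\<xi>. sobolev_weighted s G \<xi> \<partial>lebesgue)"
    define p where "p = (1 + (real N)\<^sup>2) powr (-s)"
    define r where "r = real N / 64"
    have r0: "r \<ge> 0" by (simp add: r_def)
    have X0: "X \<ge> 0" unfolding X_def by (intro Bochner_Integration.integral_nonneg) (simp add: sobolev_weighted_def)
    note bounds = sobolev_weighted_bounds[OF G W less_imp_le[OF s] r0, folded X_def]
    define L where "L = (\<lambda>\<xi>. indicator {-r..r} \<xi> * G \<xi>)"
    define H where "H = (\<lambda>\<xi>. indicator {\<xi>. \<bar>\<xi>\<bar> > r} \<xi> * G \<xi>)"
    have LL: "L \<in> L2 lebesgue" unfolding L_def by (rule L2_cutoff[OF G]) simp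
    have H_eq: "H = (\<lambda>\<xi>. G \<xi> - L \<xi>)"
      by (auto simp: H_def L_def indicator_def fun_eq_iff)
    have HL: "H \<in> L2 lebesgue" unfolding H_eq by (rule L2_diff[OF G LL])
    let ?e = "\<lambda>n. fourier (\<phi> n)"
    \<comment> \<open>For \<open>n \<ge> N\<close> the window
      \<open>\<bar>\<xi>\<bar> \<le> N / 64\<close> lies in the range where
      \<open>osc (\<psi> n)\<close> is exponentially small.\<close>
    have low: "(cmod (L2_inner lebesgue L (?e n)))\<^sup>2 \<le> X * (2 * r * C\<^sup>2) * (1/4) ^ (n div 4)" if n: "n \<ge> N" for n
    proof -
      have "(cmod (L2_inner lebesgue L (?e n)))\<^sup>2
          \<le> (L2_norm lebesgue G)\<^sup>2 * (2 * r * (C * (1/2) ^ (n div 4))\<^sup>2)"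
        unfolding L_def
      proof (rule low_frequency_coefficient[OF G r0 C])
        fix \<xi> assume "\<bar>\<xi>\<bar> \<le> r"
        then show "\<bar>\<xi>\<bar> \<le> real n / 64" using n by (simp add: r_def)
      qed
      also have "\<dots> \<le> X * (2 * r * (C * (1/2) ^ (n div 4))\<^sup>2)"
        using bounds(1) r0 by (intro mult_right_mono) auto
      also have "((1/2::real) ^ (n div 4))\<^sup>2 = (1/4) ^ (n div 4)"
        by (simp add: power2_eq_square flip: power_mult_distrib)
      then have "X * (2 * r * (C * (1/2) ^ (n div 4))\<^sup>2) = X * (2 * r * C\<^sup>2) * (1/4) ^ (n div 4)"
        by (simp add: power_mult_distrib mult_ac)
      finally show ?thesis .
    qed
    have high: "(L2_norm lebesgue H)\<^sup>2 \<le> 4096 powr s * p * X"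
    proof -
      have "(L2_norm lebesgue H)\<^sup>2 \<le> (1 + r\<^sup>2) powr (-s) * X"
        unfolding H_def by (rule bounds(2))
      also have "(1 + r\<^sup>2) powr (-s) \<le> ((1 + (real N)\<^sup>2) / 4096) powr (-s)"
        using s by (intro powr_mono2') (auto simp: r_def power_divide add_pos_nonneg)
      also have "\<dots> = 4096 powr s * p"
        unfolding p_def by (subst powr_divide) (auto simp: powr_minus divide_simps)
      finally show ?thesis using X0 by (simp add: mult_right_mono)
    qed
    have "(L2_norm I_meas (\<lambda>x. f x - partial_expansion \<psi> N f x))\<^sup>2 \<le> Q * p * X"
    proof (rule partial_expansion_error[OF f])
      fix K
      have "(\<Sum>n=N..<K. (cmod (L2_inner I_meas f (\<psi> n)))\<^sup>2)
          \<le> (\<Sum>n=N..<K. 2 * (X * (2 * r * C\<^sup>2) * (1/4) ^ (n div 4)) + 2 * (cmod (L2_inner lebesgue H (?e n)))\<^sup>2)"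
      proof (rule sum_mono)
        fix n assume "n \<in> {N..<K}"
        then have l: "(cmod (L2_inner lebesgue L (?e n)))\<^sup>2 \<le> X * (2 * r * C\<^sup>2) * (1/4) ^ (n div 4)"
          by (intro low) simp
        have "L2_inner I_meas f (\<psi> n) = L2_inner lebesgue L (?e n) + L2_inner lebesgue H (?e n)"
          unfolding coefficient_fourier[OF ft f eq] H_eq by (simp add: L2_inner_diff_left G LL fourier_\<phi>_L2)
        then have "(cmod (L2_inner I_meas f (\<psi> n)))\<^sup>2
            \<le> (cmod (L2_inner lebesgue L (?e n)) + cmod (L2_inner lebesgue H (?e n)))\<^sup>2"
          by (simp add: norm_triangle_ineq power_mono)
        also have "\<dots> \<le> 2 * (cmod (L2_inner lebesgue L (?e n)))\<^sup>2 + 2 * (cmod (L2_inner lebesgue H (?e n)))\<^sup>2"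
          using sum_squares_bound[of "cmod (L2_inner lebesgue L (?e n))" "cmod (L2_inner lebesgue H (?e n))"]
          by (simp add: power2_sum)
        finally show "(cmod (L2_inner I_meas f (\<psi> n)))\<^sup>2
            \<le> 2 * (X * (2 * r * C\<^sup>2) * (1/4) ^ (n div 4)) + 2 * (cmod (L2_inner lebesgue H (?e n)))\<^sup>2"
          using l by linarith
      qed
      also have "\<dots> = 2 * (X * (2 * r * C\<^sup>2)) * (\<Sum>n=N..<K. (1/4) ^ (n div 4))
          + 2 * (\<Sum>n=N..<K. (cmod (L2_inner lebesgue H (?e n)))\<^sup>2)"
        unfolding sum.distrib sum_distrib_left by (simp add: mult.assoc)
      also have "\<dots> \<le> 2 * (X * (2 * r * C\<^sup>2)) * (16 * (3/4) ^ N) + 2 * (4096 powr s * p * X)"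
      proof (intro add_mono mult_left_mono geometric_div4_sum)
        show "(\<Sum>n=N..<K. (cmod (L2_inner lebesgue H (?e n)))\<^sup>2) \<le> 4096 powr s * p * X"
          using L2_Bessel[OF fourier_\<phi>_orthonormal HL, of "{N..<K}"] high by simp
      qed (use X0 r0 in auto)
      \<comment> \<open>With \<open>r = N / 64\<close> the numerical factors multiply to 1.\<close>
      also have "2 * (X * (2 * r * C\<^sup>2)) * (16 * (3/4) ^ N) = X * C\<^sup>2 * (real N * (3/4) ^ N)"
        by (simp add: r_def)
      also have "\<dots> + 2 * (4096 powr s * p * X) \<le> X * C\<^sup>2 * (B * p) + 2 * (4096 powr s * p * X)"
        using B(2)[of N] X0 by (intro add_right_mono mult_left_mono) (auto simp: p_def)
      also have "\<dots> = Q * p * X" by (simp add: Q_def algebra_simps)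
      finally show "(\<Sum>n=N..<K. (cmod (L2_inner I_meas f (\<psi> n)))\<^sup>2) \<le> Q * p * X" .
    qed
    then have "L2_norm I_meas (\<lambda>x. f x - partial_expansion \<psi> N f x) \<le> sqrt (Q * p * X)"
      by (rule real_le_rsqrt)
    also have "\<dots> = sqrt Q * (1 + (real N)\<^sup>2) powr (- s / 2) * sqrt X"
    proof -
      have "sqrt p = (1 + (real N)\<^sup>2) powr (- s / 2)"
        by (simp add: p_def powr_half_sqrt[symmetric] powr_powr)
      then show ?thesis by (simp add: real_sqrt_mult)
    qed
    finally show "L2_norm I_meas (\<lambda>x. f x - partial_expansion \<psi> N f x)
      \<le> sqrt Q * (1 + (real N)\<^sup>2) powr (- s / 2) * sqrt (\<integral>\<xi>. sobolev_weighted s G \<xi> \<partial>lebesgue)"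
      by (simp add: X_def)
  qed (use Q0 in simp)
qed

end

section \<open>Passage to the quotient norm\<close>

theorem corollary2:
  fixes c s :: real and \<mu> :: "nat \<Rightarrow> real" and \<psi> :: "nat \<Rightarrow> real \<Rightarrow> complex"
  assumes "c \<ge> 1" and "s > 0" and "pswf c \<mu> \<psi>"
  shows "\<exists>M a M' Ms :: real. M \<ge> sqrt 2 \<and> a > 0 \<and> M' > 0 \<and> Ms > 0 \<and>
    (\<forall>f\<in>sobolev s. \<forall>N::nat. real N \<ge> max (c * M) 3 \<longrightarrow>
       L2_norm I_meas (\<lambda>x. f x - partial_expansion \<psi> N f x)
         \<le> Ms * (1 + (real N)\<^sup>2) powr (- s / 2) * sobolev_norm s f
           + M' * exp (- a * real N) * L2_norm I_meas f)"
proof -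
  interpret pswf_basis c \<mu> \<psi> using assms by unfold_locales
  obtain Ms where Ms: "Ms > 0" and err: "\<And>f F G N. f \<in> L2 I_meas \<Longrightarrow> (F, G) \<in> sobolev_ext s f \<Longrightarrow> N \<ge> 1 \<Longrightarrow>
    L2_norm I_meas (\<lambda>x. f x - partial_expansion \<psi> N f x)
      \<le> Ms * (1 + (real N)\<^sup>2) powr (- s / 2) * sqrt (\<integral>\<xi>. sobolev_weighted s G \<xi> \<partial>lebesgue)"
    using expansion_error_extension[OF assms(2)] by blast
  show ?thesis
  \<comment> \<open>The exponentially small low-frequency part is already absorbed into
    \<open>Ms\<close>, so the simplest admissible values serve for \<open>M\<close>,
    \<open>a\<close> and \<open>M'\<close>.\<close>
  proof (rule exI[of _ "sqrt 2"], rule exI[of _ 1], rule exI[of _ 1], rule exI[of _ Ms],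
      intro conjI ballI allI impI)
    fix f and N :: nat
    assume f: "f \<in> sobolev s" and N: "max (c * sqrt 2) 3 \<le> real N"
    define k where "k = Ms * (1 + (real N)\<^sup>2) powr (- s / 2)"
    define e where "e = L2_norm I_meas (\<lambda>x. f x - partial_expansion \<psi> N f x)"
    have "1 + (real N)\<^sup>2 \<noteq> 0" by (simp add: add_nonneg_eq_0_iff)
    then have k: "k > 0" using Ms by (simp add: k_def)
    \<comment> \<open>Dividing by \<open>k > 0\<close> makes the left side a lower bound for the
      norms of all extensions, hence for their infimum; membership in \<open>sobolev s\<close> makes
      the set of extensions nonempty.\<close>
    have "e / k \<le> sobolev_norm s f"
      unfolding sobolev_norm_def
    proof (rule cINF_greatest)
      show "sobolev_ext s f \<noteq> {}" using f by (simp add: sobolev_def)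
      fix FG assume FG: "FG \<in> sobolev_ext s f"
      obtain F G where [simp]: "FG = (F, G)" by (cases FG)
      have "e \<le> k * sqrt (\<integral>\<xi>. sobolev_weighted s G \<xi> \<partial>lebesgue)"
        unfolding e_def k_def using f FG N by (intro err[of f F G]) (auto simp: sobolev_def)
      then show "e / k \<le> (case FG of (F, G) \<Rightarrow> sqrt (\<integral>\<xi>. sobolev_weighted s G \<xi> \<partial>lebesgue))"
        using k by (simp add: divide_simps mult.commute)
    qed
    then have "e \<le> k * sobolev_norm s f" using k by (simp add: divide_simps mult.commute)
    moreover have "0 \<le> 1 * exp (- 1 * real N) * L2_norm I_meas f" by simp
    ultimately show "L2_norm I_meas (\<lambda>x. f x - partial_expansion \<psi> N f x)
         \<le> Ms * (1 + (real N)\<^sup>2) powr (- s / 2) * sobolev_norm s f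
           + 1 * exp (- 1 * real N) * L2_norm I_meas f"
      unfolding e_def k_def by linarith
  qed (use Ms in auto)
qed

end
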